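(* Let $n\ge 2$, let $a<b$ be real numbers, and let $W\in C^{1,1}_{loc}(\mathbb{R})$ be a nonnegative potential such that $W'(a)=W'(b)=0$, $W'<0$ on $(a,b)$, and $W(b)=0$. Assume $u\in C^2(\mathbb{R}^n)$ is an entire solution of $\Delta u=W'(u)$ in $\mathbb{R}^n$ such that, for some $R>0$, $u(x)\in(a,b]$ for all $x\in\mathbb{R}^n\setminus B_R$. Suppose that either $n=2$, or $n\ge 3$ and there exist $C_0>0$ and $s_0\in(a,b)$ such that $W'(s)\le -C_0(s-a)^{\frac{n}{n-2}}$ for all $s\in[a,s_0]$. Then $u\equiv b$.
   Context: $B_R\subset\mathbb{R}^n$ denotes the open ball of radius $R$ centred at the origin. *)

theory Defs
  imports "HOL-Analysis.Analysis"
begin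

(* The class of twice continuously (Frechet) differentiable functions on the whole space; D1 and D2
   are the first and second derivative, as maps into spaces of bounded linear operators. *)
definition C2 :: "('a::real_normed_vector \<Rightarrow> 'b::real_normed_vector) \<Rightarrow> bool" where
  "C2 u \<longleftrightarrow> (\<exists>(D1 :: 'a \<Rightarrow> 'a \<Rightarrow>\<^sub>L 'b) (D2 :: 'a \<Rightarrow> 'a \<Rightarrow>\<^sub>L 'a \<Rightarrow>\<^sub>L 'b).
     (\<forall>x. (u has_derivative blinfun_apply (D1 x)) (at x)) \<and>
     (\<forall>x. (D1 has_derivative blinfun_apply (D2 x)) (at x)) \<and>
     continuous_on UNIV D2)"

definition partial_deriv :: "'n::finite \<Rightarrow> (real ^ 'n \<Rightarrow> real) \<Rightarrow> real ^ 'n \<Rightarrow> real" where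
  "partial_deriv i f x = deriv (\<lambda>t. f (x + t *\<^sub>R axis i 1)) 0"

definition laplacian :: "(real ^ 'n::finite \<Rightarrow> real) \<Rightarrow> real ^ 'n \<Rightarrow> real" where
  "laplacian f x = (\<Sum>i\<in>UNIV. partial_deriv i (partial_deriv i f) x)"

definition C11_loc :: "(real \<Rightarrow> real) \<Rightarrow> bool" where
  "C11_loc W \<longleftrightarrow> (\<forall>s. W differentiable (at s)) \<and>
     (\<forall>K. compact K \<longrightarrow> (\<exists>L. L-lipschitz_on K (deriv W)))"

end

(* Parabolicity of the exterior domain (n = 2), or iterated comparison with radial barriers using the
   critical exponent n/(n-2) (n >= 3), keeps u away from a near infinity; since W' < 0 on (a,b), this
   forces u -> b. Then b - u is a nonnegative bounded subharmonic function near infinity, of size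
   O(|x|^(2-n)) if n >= 3, and Caccioppoli's inequality shows that u has finite Dirichlet energy.
   Testing the Pohozaev identity with the field (r^2 + |x|^2)^(-n/2) x cancels the potential terms
   outside the ball of radius r to leading order, and leaves
     c * int_{|x| < r} W(u)  <=  (3/2) * int |x|^2 / (r^2 + |x|^2) |grad u|^2.
   The right-hand side tends to 0 as r -> infinity, so W(u) vanishes identically, hence u = b outside
   a ball, W'(u) = 0 because W >= 0, u is harmonic, and the maximum principle gives u = b. *)

theory Submission
  imports Defs
begin

section \<open>Twice continuously differentiable functions\<close>

text \<open>The exponent p = n/(n-2) is borderline. While u is near a, a bound u - a >= N |x|^(2-n)
  makes -W'(u) at least a multiple of N^p |x|^(-n), the rate at which solving Poisson's equation
  again returns |x|^(2-n), up to a logarithm. One comparison thus enlarges N but not the rate; the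
  bound becomes uniform because p > 1 lets a large N gain as much as doubling the radius loses. In
  the last step W(u) is not known to be integrable: only W(u) -> 0 at infinity and finite energy are
  available. The cut-off at radius K must therefore cost no more than a multiple of K^(-n) int_{|x|
  < K} W(u), an average that tends to 0 as K -> infinity with r fixed. The weight exponent n/2 comes
  from div(f x) = n f + 2 s f' with s = |x|^2: for f = (r^2 + s)^(-n/2) this equals n f r^2 / (r^2 +
  s), which is positive and small compared with f far out. Radial functions are written in the
  variable s = |x|^2; this avoids the singularity of |x| at the origin and gives the Laplacian the
  form 4 s f'' + 2 n f'.\<close>

locale C2_fun =
  fixes u :: "real ^ 'n::finite \<Rightarrow> real"
    and D1 :: "real ^ 'n \<Rightarrow> (real ^ 'n) \<Rightarrow>\<^sub>L real"
    and D2 :: "real ^ 'n \<Rightarrow> (real ^ 'n) \<Rightarrow>\<^sub>L (real ^ 'n) \<Rightarrow>\<^sub>L real"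
  assumes D1: "\<And>x. (u has_derivative blinfun_apply (D1 x)) (at x)"
    and D2: "\<And>x. (D1 has_derivative blinfun_apply (D2 x)) (at x)"
    and D2_cont: "continuous_on UNIV D2"
begin

lemma DERIV_line: "((\<lambda>t. u (x + t *\<^sub>R e)) has_real_derivative D1 (x + t *\<^sub>R e) e) (at t)"
proof -
  have "((\<lambda>t. u (x + t *\<^sub>R e)) has_derivative (\<lambda>h. D1 (x + t *\<^sub>R e) (h *\<^sub>R e))) (at t)"
    by (rule has_derivative_compose[OF _ D1]) (auto intro!: derivative_eq_intros)
  then show ?thesis
    unfolding has_field_derivative_def
    by (rule has_derivative_eq_rhs) (simp add: blinfun.scaleR_right fun_eq_iff mult.commute)
qed

lemma DERIV_D1_line:
  "((\<lambda>t. D1 (x + t *\<^sub>R f) e) has_real_derivative D2 (x + t *\<^sub>R f) f e) (at t)"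
proof -
  have *: "((\<lambda>t. D1 (x + t *\<^sub>R f)) has_derivative (\<lambda>h. D2 (x + t *\<^sub>R f) (h *\<^sub>R f))) (at t)"
    by (rule has_derivative_compose[OF _ D2]) (auto intro!: derivative_eq_intros)
  have "((\<lambda>t. D1 (x + t *\<^sub>R f) e) has_derivative (\<lambda>h. D2 (x + t *\<^sub>R f) (h *\<^sub>R f) e)) (at t)"
    using bounded_linear.has_derivative[OF blinfun.bounded_linear_left *] .
  then show ?thesis
    unfolding has_field_derivative_def
    by (rule has_derivative_eq_rhs)
      (simp add: blinfun.scaleR_right blinfun.scaleR_left fun_eq_iff mult.commute)
qed

lemma cont_u: "continuous_on A u"
  using D1 by (meson continuous_at_imp_continuous_on has_derivative_continuous)

lemma cont_D1: "continuous_on A D1"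
  using D2 by (meson continuous_at_imp_continuous_on has_derivative_continuous)

lemma cont_D1_apply [continuous_intros]:
  "continuous_on A f \<Longrightarrow> continuous_on A g \<Longrightarrow> continuous_on A (\<lambda>x. D1 (f x) (g x))"
  by (intro blinfun.continuous_on continuous_on_compose2[OF cont_D1[of UNIV]]) auto

lemma cont_D2_apply [continuous_intros]:
  "continuous_on A f \<Longrightarrow> continuous_on A g \<Longrightarrow> continuous_on A h \<Longrightarrow>
    continuous_on A (\<lambda>x. D2 (f x) (g x) (h x))"
  by (intro blinfun.continuous_on continuous_on_compose2[OF D2_cont]) auto

lemma partial_deriv_u: "partial_deriv i u = (\<lambda>x. D1 x (axis i 1))"
  unfolding partial_deriv_def using DERIV_imp_deriv[OF DERIV_line[of _ _ 0]] by simp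

lemma laplacian_u: "laplacian u x = (\<Sum>i\<in>UNIV. D2 x (axis i 1) (axis i 1))"
  unfolding laplacian_def partial_deriv_u
  unfolding partial_deriv_def using DERIV_imp_deriv[OF DERIV_D1_line[of _ _ _ 0]] by simp

text \<open>The mean value theorem is applied twice, first along \<open>e\<close> and then along
  \<open>f\<close>. Exchanging \<open>e\<close> and \<open>f\<close> leaves the second difference
  unchanged but produces the other mixed derivative.\<close>

lemma second_difference:
  assumes "h > 0"
  obtains t s where "0 < t" "t < h" "0 < s" "s < h"
    "u (x + h *\<^sub>R e + h *\<^sub>R f) - u (x + h *\<^sub>R e) - u (x + h *\<^sub>R f) + u x =
      h * h * D2 (x + t *\<^sub>R e + s *\<^sub>R f) f e"
proof -
  define g where "g t = u ((x + h *\<^sub>R f) + t *\<^sub>R e) - u (x + t *\<^sub>R e)" for t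
  have "(g has_real_derivative (D1 ((x + h *\<^sub>R f) + t *\<^sub>R e) e - D1 (x + t *\<^sub>R e) e)) (at t)" for t
    unfolding g_def by (intro DERIV_diff DERIV_line)
  from MVT2[OF assms this] obtain t where t: "0 < t" "t < h"
    "g h - g 0 = h * (D1 ((x + h *\<^sub>R f) + t *\<^sub>R e) e - D1 (x + t *\<^sub>R e) e)"
    by auto
  have "((\<lambda>s. D1 ((x + t *\<^sub>R e) + s *\<^sub>R f) e) has_real_derivative
      D2 ((x + t *\<^sub>R e) + s *\<^sub>R f) f e) (at s)" for s
    by (rule DERIV_D1_line)
  from MVT2[OF assms this] obtain s where s: "0 < s" "s < h"
    "D1 ((x + t *\<^sub>R e) + h *\<^sub>R f) e - D1 (x + t *\<^sub>R e) e = h * D2 ((x + t *\<^sub>R e) + s *\<^sub>R f) f e"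
    by auto
  show thesis
  proof (rule that[OF t(1,2) s(1,2)])
    show "u (x + h *\<^sub>R e + h *\<^sub>R f) - u (x + h *\<^sub>R e) - u (x + h *\<^sub>R f) + u x =
      h * h * D2 (x + t *\<^sub>R e + s *\<^sub>R f) f e"
      using t(3) s(3) by (simp add: g_def algebra_simps)
  qed
qed

text \<open>Schwarz's theorem: both mixed derivatives are limits of the same second difference
  quotient, and \<open>D2\<close> is continuous. Symmetry is what cancels the second-order terms in
  \<open>pohozaev_identity\<close>.\<close>

lemma D2_sym: "D2 x e f = D2 x f e"
proof (rule ccontr)
  assume ne: "D2 x e f \<noteq> D2 x f e"
  define \<epsilon> where "\<epsilon> = \<bar>D2 x e f - D2 x f e\<bar> / 2"
  have \<epsilon>: "\<epsilon> > 0" using ne by (simp add: \<epsilon>_def)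
  have "continuous (at x) (\<lambda>y. D2 y a b)" for a b
    using cont_D2_apply[OF continuous_on_id continuous_on_const continuous_on_const, of UNIV]
    by (simp add: continuous_on_eq_continuous_at)
  then have "\<exists>d>0. \<forall>y. dist y x < d \<longrightarrow> dist (D2 y a b) (D2 x a b) < \<epsilon>" for a b
    using \<epsilon> unfolding continuous_at_eps_delta by blast
  then obtain d1 d2 where d: "d1 > 0" "d2 > 0"
    "\<And>y. dist y x < d1 \<Longrightarrow> dist (D2 y e f) (D2 x e f) < \<epsilon>"
    "\<And>y. dist y x < d2 \<Longrightarrow> dist (D2 y f e) (D2 x f e) < \<epsilon>"
    by metis
  \<comment> \<open>Both intermediate points are within \<open>h * (norm e + norm f)\<close> of
    \<open>x\<close>; the summand 1 covers the case that \<open>e\<close> and \<open>f\<close>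
    vanish.\<close>
  define h where "h = min d1 d2 / (1 + norm e + norm f)"
  have pos: "1 + norm e + norm f > 0" by (smt (verit) norm_ge_zero)
  have h: "h > 0" using d pos by (simp add: h_def)
  have near: "dist (x + t *\<^sub>R a + s *\<^sub>R b) x < min d1 d2"
    if "0 < t" "t < h" "0 < s" "s < h" "{a, b} = {e, f}" for t s a b
  proof -
    have "dist (x + t *\<^sub>R a + s *\<^sub>R b) x = norm (t *\<^sub>R a + s *\<^sub>R b)"
      by (simp add: dist_norm algebra_simps)
    also have "\<dots> \<le> t * norm a + s * norm b"
      using norm_triangle_ineq[of "t *\<^sub>R a" "s *\<^sub>R b"] that by simp
    also have "\<dots> \<le> h * norm a + h * norm b"
      using that by (intro add_mono mult_right_mono) auto
    also have "\<dots> = h * (norm e + norm f)"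
      using that(5) by (auto simp: doubleton_eq_iff algebra_simps)
    also have "\<dots> < h * (1 + norm e + norm f)" using h by (simp add: algebra_simps)
    also have "\<dots> = min d1 d2" using pos by (simp add: h_def)
    finally show ?thesis .
  qed
  obtain t s where ts: "0 < t" "t < h" "0 < s" "s < h"
    "u (x + h *\<^sub>R e + h *\<^sub>R f) - u (x + h *\<^sub>R e) - u (x + h *\<^sub>R f) + u x =
      h * h * D2 (x + t *\<^sub>R e + s *\<^sub>R f) f e"
    using second_difference[OF h] by blast
  obtain t' s' where ts': "0 < t'" "t' < h" "0 < s'" "s' < h"
    "u (x + h *\<^sub>R f + h *\<^sub>R e) - u (x + h *\<^sub>R f) - u (x + h *\<^sub>R e) + u x =
      h * h * D2 (x + t' *\<^sub>R f + s' *\<^sub>R e) e f"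
    using second_difference[OF h] by blast
  have "u (x + h *\<^sub>R e + h *\<^sub>R f) = u (x + h *\<^sub>R f + h *\<^sub>R e)"
    by (simp add: add.commute add.left_commute)
  with ts(5) ts'(5) have "h * h * D2 (x + t *\<^sub>R e + s *\<^sub>R f) f e = h * h * D2 (x + t' *\<^sub>R f + s' *\<^sub>R e) e f"
    by linarith
  with h have eq: "D2 (x + t *\<^sub>R e + s *\<^sub>R f) f e = D2 (x + t' *\<^sub>R f + s' *\<^sub>R e) e f" by simp
  have "dist (D2 (x + t *\<^sub>R e + s *\<^sub>R f) f e) (D2 x f e) < \<epsilon>"
    using d(4) near[OF ts(1-4)] by auto
  moreover have "dist (D2 (x + t' *\<^sub>R f + s' *\<^sub>R e) e f) (D2 x e f) < \<epsilon>"
    using d(3) near[OF ts'(1-4)] by auto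
  ultimately show False
    using eq unfolding \<epsilon>_def dist_real_def by (smt (verit) field_sum_of_halves)
qed

end

lemma C2_imp_C2_fun:
  assumes "C2 u"
  obtains D1 D2 where "C2_fun u D1 D2"
  using assms unfolding C2_def C2_fun_def by metis

section \<open>Radial comparison functions\<close>

text \<open>If \<open>g2\<close> were negative, \<open>g'\<close> would be negative just to the
  right of its zero at 0, and the mean value theorem would bring \<open>g\<close> below its
  minimum.\<close>

lemma second_derivative_nonneg_at_min:
  fixes g g' :: "real \<Rightarrow> real"
  assumes d: "d > 0" and g: "\<And>t. \<bar>t\<bar> < d \<Longrightarrow> (g has_real_derivative g' t) (at t)"
    and g': "(g' has_real_derivative g2) (at 0)"
    and min: "\<And>t. \<bar>t\<bar> < d \<Longrightarrow> g 0 \<le> g t"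
  shows "g2 \<ge> 0"
proof (rule ccontr)
  assume "\<not> g2 \<ge> 0"
  then have neg: "g2 < 0" by simp
  have "g' 0 = 0"
    by (rule DERIV_local_min[OF g d]) (use d min in auto)
  then obtain k where k: "k > 0" "\<And>h. 0 < h \<Longrightarrow> h < k \<Longrightarrow> g' h < 0"
    using DERIV_neg_dec_right[OF g' neg] by auto
  define h where "h = min d k / 2"
  have h: "0 < h" "h < d" "h < k" using d k by (auto simp: h_def)
  obtain t where t: "0 < t" "t < h" "g h - g 0 = (h - 0) * g' t"
    using MVT2[OF h(1), of g g'] g h by (metis abs_less_iff abs_of_nonneg less_le_trans
      less_minus_iff neg_0_less_iff_less order.strict_trans1 order_less_imp_le order_le_less_trans)
  have "g' t < 0" using t h k by auto
  then have "g h < g 0" using t h by (simp add: mult_pos_neg) (smt (verit) mult_pos_neg)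
  with min[of h] h show False by auto
qed

lemma sum_axis_sq: "(\<Sum>i\<in>UNIV. (x $ i)\<^sup>2) = (norm (x :: real ^ 'n::finite))\<^sup>2"
  unfolding power2_norm_eq_inner by (simp add: inner_vec_def power2_eq_square)

lemma norm_line_sq:
  "(norm (x + t *\<^sub>R axis i 1 :: real ^ 'n::finite))\<^sup>2 = (norm x)\<^sup>2 + 2 * t * (x $ i) + t\<^sup>2"
  unfolding power2_norm_eq_inner
  by (simp add: inner_add_left inner_add_right inner_axis inner_commute[of "axis i 1"]
      power2_eq_square algebra_simps)

context C2_fun
begin

text \<open>The right-hand side is the Laplacian of the radial function \<open>f\<close> of the
  squared distance to \<open>c\<close>. The second derivative test is applied on each coordinate
  line and summed; the squared distance is smooth, so \<open>y = c\<close> needs no separate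
  treatment.\<close>

lemma laplacian_at_touching_min:
  assumes d: "d > 0"
    and f: "\<And>s. \<bar>s - (norm (y - c))\<^sup>2\<bar> < d \<Longrightarrow> (f has_real_derivative f' s) (at s)"
    and f': "(f' has_real_derivative f'') (at ((norm (y - c))\<^sup>2))"
    and min: "\<And>z. dist z y < d \<Longrightarrow> u y - f ((norm (y - c))\<^sup>2) \<le> u z - f ((norm (z - c))\<^sup>2)"
  shows "laplacian u y \<ge> 4 * (norm (y - c))\<^sup>2 * f'' + 2 * real CARD('n) * f' ((norm (y - c))\<^sup>2)"
proof -
  define s where "s = (norm (y - c))\<^sup>2"
  have comp: "D2 y (axis i 1) (axis i 1) \<ge> 4 * ((y - c) $ i)\<^sup>2 * f'' + 2 * f' s" for i
  proof -
    define S where "S t = s + 2 * t * ((y - c) $ i) + t\<^sup>2" for t :: real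
    have S: "(norm (y + t *\<^sub>R axis i 1 - c))\<^sup>2 = S t" for t
      using norm_line_sq[of "y - c" t i] by (simp add: S_def s_def algebra_simps)
    have S0: "S 0 = s" by (simp add: S_def)
    have DS: "(S has_real_derivative (2 * ((y - c) $ i) + 2 * t)) (at t)" for t
      unfolding S_def by (auto intro!: derivative_eq_intros)
    have "isCont S 0" using DS DERIV_isCont by blast
    then obtain e where e: "e > 0" "\<And>t. \<bar>t\<bar> < e \<Longrightarrow> \<bar>S t - s\<bar> < d"
      using d unfolding continuous_at_eps_delta S0 by (auto simp: dist_real_def)
    define g where "g t = u (y + t *\<^sub>R axis i 1) - f (S t)" for t
    define g' where "g' t = D1 (y + t *\<^sub>R axis i 1) (axis i 1) - f' (S t) * (2 * ((y - c) $ i) + 2 * t)" for t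
    have "D2 (y + 0 *\<^sub>R axis i 1) (axis i 1) (axis i 1) -
        (f'' * (2 * ((y - c) $ i) + 2 * 0) * (2 * ((y - c) $ i) + 2 * 0) + f' (S 0) * 2) \<ge> 0"
    proof (rule second_derivative_nonneg_at_min[of "min d e" g g'])
      show "min d e > 0" using d e by simp
      show "(g has_real_derivative g' t) (at t)" if "\<bar>t\<bar> < min d e" for t
        unfolding g_def g'_def
        using that e f by (intro DERIV_diff DERIV_line DERIV_chain2[OF _ DS]) (auto simp: s_def)
      have "((\<lambda>t. f' (S t)) has_real_derivative f'' * (2 * ((y - c) $ i) + 2 * 0)) (at 0)"
        by (rule DERIV_chain2[OF _ DS]) (use f' in \<open>simp add: S0 s_def\<close>)
      then have "((\<lambda>t. f' (S t) * (2 * ((y - c) $ i) + 2 * t)) has_real_derivative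
          (f'' * (2 * ((y - c) $ i) + 2 * 0) * (2 * ((y - c) $ i) + 2 * 0) + f' (S 0) * 2)) (at 0)"
        by (auto intro!: derivative_eq_intros)
      then show "(g' has_real_derivative D2 (y + 0 *\<^sub>R axis i 1) (axis i 1) (axis i 1) -
        (f'' * (2 * ((y - c) $ i) + 2 * 0) * (2 * ((y - c) $ i) + 2 * 0) + f' (S 0) * 2)) (at 0)"
        unfolding g'_def by (intro DERIV_diff DERIV_D1_line)
      show "g 0 \<le> g t" if "\<bar>t\<bar> < min d e" for t
        using min[of "y + t *\<^sub>R axis i 1"] that unfolding g_def S[symmetric]
        by (simp add: dist_norm)
    qed
    then show ?thesis by (simp add: S0 power2_eq_square algebra_simps)
  qed
  have "laplacian u y \<ge> (\<Sum>i\<in>(UNIV::'n set). 4 * ((y - c) $ i)\<^sup>2 * f'' + 2 * f' s)"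
    unfolding laplacian_u by (intro sum_mono comp)
  also have "(\<Sum>i\<in>(UNIV::'n set). 4 * ((y - c) $ i)\<^sup>2 * f'' + 2 * f' s)
      = 4 * (norm (y - c))\<^sup>2 * f'' + 2 * real CARD('n) * f' s"
    by (simp add: sum.distrib sum_axis_sq[symmetric] sum_distrib_left sum_distrib_right del: vector_minus_component)
  finally show ?thesis by (simp add: s_def)
qed

text \<open>Comparison on an unbounded domain: \<open>inf\<close> serves as the boundary condition
  at infinity. Strictness is required only where \<open>u\<close> lies below the barrier, so a
  nonlinear right-hand side can be estimated there from the barrier itself.\<close>

lemma exterior_comparison:
  assumes R: "R > 0" and x: "norm x \<ge> R"
    and f: "\<And>s. s > R\<^sup>2 \<Longrightarrow> (f has_real_derivative f' s) (at s)"
    and f': "\<And>s. s > R\<^sup>2 \<Longrightarrow> (f' has_real_derivative f'' s) (at s)"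
    and cont: "continuous_on {R\<^sup>2..} f"
    and bd: "\<And>x. norm x = R \<Longrightarrow> f (R\<^sup>2) \<le> u x"
    and inf: "\<And>\<epsilon>. \<epsilon> > 0 \<Longrightarrow> \<exists>K. \<forall>x. norm x \<ge> K \<longrightarrow> f ((norm x)\<^sup>2) - \<epsilon> \<le> u x"
    and strict: "\<And>x. norm x > R \<Longrightarrow> u x < f ((norm x)\<^sup>2) \<Longrightarrow>
       laplacian u x < 4 * (norm x)\<^sup>2 * f'' ((norm x)\<^sup>2) + 2 * real CARD('n) * f' ((norm x)\<^sup>2)"
  shows "f ((norm x)\<^sup>2) \<le> u x"
proof (rule ccontr)
  define h where "h z = u z - f ((norm z)\<^sup>2)" for z
  assume "\<not> ?thesis"
  then have neg: "h x < 0" by (simp add: h_def)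
  \<comment> \<open>As \<open>h x\<close> is negative, \<open>h x / 2\<close> exceeds it, so a
    minimum over the annulus \<open>A\<close> cannot lie on its outer sphere; \<open>bd\<close>
    excludes the inner one.\<close>
  obtain K0 where K0: "\<And>z. norm z \<ge> K0 \<Longrightarrow> h z \<ge> h x / 2"
    using inf[of "- h x / 2"] neg unfolding h_def by (auto simp: field_simps)
  define K where "K = max K0 (norm x + 1)"
  define A where "A = cball 0 K - ball (0::real^'n) R"
  have "compact A" unfolding A_def by (intro compact_diff) auto
  moreover have "x \<in> A" using x by (auto simp: A_def K_def)
  moreover have "continuous_on A h"
    unfolding h_def
    using R by (intro continuous_intros cont_u continuous_on_compose2[OF cont])
      (auto simp: A_def intro!: power_mono)
  ultimately obtain y where y: "y \<in> A" "\<And>z. z \<in> A \<Longrightarrow> h y \<le> h z"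
    using continuous_attains_inf[of A h] by auto
  have hy: "h y \<le> h x" using y \<open>x \<in> A\<close> by auto
  have yK: "norm y < K"
    using K0[of y] y(1) hy neg by (cases "norm y < K") (auto simp: A_def K_def)
  have yR: "norm y > R"
    using bd[of y] y(1) hy neg by (cases "norm y > R") (auto simp: A_def h_def)
  have sq: "(norm y)\<^sup>2 > R\<^sup>2" using yR R by (simp add: power_strict_mono)
  \<comment> \<open>The first entry keeps the argument of \<open>f\<close> above
    \<open>R\<^sup>2\<close>, the other two keep the competitors \<open>z\<close> inside
    \<open>A\<close>.\<close>
  define d where "d = min ((norm y)\<^sup>2 - R\<^sup>2) (min (K - norm y) (norm y - R))"
  have "laplacian u y \<ge> 4 * (norm (y - 0))\<^sup>2 * f'' ((norm y)\<^sup>2) + 2 * real CARD('n) * f' ((norm (y - 0))\<^sup>2)"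
  proof (rule laplacian_at_touching_min[of d y 0 f f' "f'' ((norm y)\<^sup>2)"])
    show "d > 0" using sq yK yR by (simp add: d_def)
    show "(f has_real_derivative f' s) (at s)" if "\<bar>s - (norm (y - 0))\<^sup>2\<bar> < d" for s
      using that by (intro f) (auto simp: d_def)
    show "(f' has_real_derivative f'' ((norm y)\<^sup>2)) (at ((norm (y - 0))\<^sup>2))"
      using f'[OF sq] by simp
    show "u y - f ((norm (y - 0))\<^sup>2) \<le> u z - f ((norm (z - 0))\<^sup>2)" if "dist z y < d" for z
    proof -
      have "\<bar>norm z - norm y\<bar> < d" using that norm_triangle_ineq3[of z y] by (simp add: dist_norm)
      then have "z \<in> A" by (auto simp: A_def d_def)
      then show ?thesis using y(2) by (simp add: h_def)
    qed
  qed
  moreover have "u y < f ((norm y)\<^sup>2)" using hy neg by (simp add: h_def)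
  ultimately show False using strict[OF yR] by simp
qed

text \<open>Subtracting a small multiple of the squared norm makes the minimum principle strict: an
  interior minimum of the difference would force a positive Laplacian of \<open>u\<close>.\<close>

lemma harmonic_ge_exterior_value:
  assumes harm: "\<And>x. laplacian u x = 0" and out: "\<And>x. norm x \<ge> R \<Longrightarrow> u x = b"
  shows "u x \<ge> b"
proof (rule ccontr)
  assume "\<not> u x \<ge> b"
  then have lt: "u x < b" by simp
  have xR: "norm x < R" using out[of x] lt by (cases "norm x < R") auto
  then have R: "R > 0" by (smt (verit) norm_ge_zero)
  \<comment> \<open>The perturbation is at most half of \<open>b - u x\<close> on the ball, too
    little to move the minimum to the boundary sphere.\<close>
  define \<epsilon> where "\<epsilon> = (b - u x) / (2 * R\<^sup>2)"
  have \<epsilon>: "\<epsilon> > 0" "\<epsilon> * R\<^sup>2 < b - u x" using lt R by (auto simp: \<epsilon>_def field_simps)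
  obtain y where y: "y \<in> cball 0 R" "\<And>z. z \<in> cball 0 R \<Longrightarrow> u y - \<epsilon> * (norm y)\<^sup>2 \<le> u z - \<epsilon> * (norm z)\<^sup>2"
  proof -
    have "continuous_on (cball 0 R) (\<lambda>z. u z - \<epsilon> * (norm z)\<^sup>2)"
      by (intro continuous_intros cont_u)
    then show thesis
      using continuous_attains_inf[of "cball 0 R" "\<lambda>z. u z - \<epsilon> * (norm z)\<^sup>2"] R that by auto
  qed
  have yx: "u y - \<epsilon> * (norm y)\<^sup>2 \<le> u x"
    using y(2)[of x] xR \<epsilon> by (smt (verit) mem_cball_0 mult_nonneg_nonneg zero_le_power2)
  have yR: "norm y < R"
  proof (rule ccontr)
    assume "\<not> norm y < R"
    then have "norm y = R" using y(1) by simp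
    then show False using out[of y] yx \<epsilon> by simp
  qed
  have "laplacian u y \<ge> 4 * (norm (y - 0))\<^sup>2 * 0 + 2 * real CARD('n) * \<epsilon>"
  proof (rule laplacian_at_touching_min[of "R - norm y" y 0 "\<lambda>s. \<epsilon> * s" "\<lambda>_. \<epsilon>" 0])
    show "R - norm y > 0" using yR by simp
    show "((*) \<epsilon> has_real_derivative \<epsilon>) (at s)" for s by (auto intro!: derivative_eq_intros)
    show "u y - \<epsilon> * (norm (y - 0))\<^sup>2 \<le> u z - \<epsilon> * (norm (z - 0))\<^sup>2" if "dist z y < R - norm y" for z
      using y(2)[of z] that norm_triangle_ineq3[of z y] by (simp add: dist_norm)
  qed auto
  moreover have "2 * real CARD('n) * \<epsilon> > 0" using \<epsilon> by simp
  ultimately show False using harm[of y] by simp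
qed

lemma C2_fun_uminus: "C2_fun (\<lambda>x. - u x) (\<lambda>x. - D1 x) (\<lambda>x. - D2 x)"
proof
  show "((\<lambda>x. - u x) has_derivative blinfun_apply (- D1 x)) (at x)" for x
    using has_derivative_minus[OF D1[of x]] by (simp add: uminus_blinfun.rep_eq)
  show "((\<lambda>x. - D1 x) has_derivative blinfun_apply (- D2 x)) (at x)" for x
    using has_derivative_minus[OF D2[of x]] by (simp add: uminus_blinfun.rep_eq)
  show "continuous_on UNIV (\<lambda>x. - D2 x)" using D2_cont by (intro continuous_intros)
qed

lemma harmonic_eq_exterior_value:
  assumes harm: "\<And>x. laplacian u x = 0" and out: "\<And>x. norm x \<ge> R \<Longrightarrow> u x = b"
  shows "u x = b"
proof -
  interpret m: C2_fun "\<lambda>x. - u x" "\<lambda>x. - D1 x" "\<lambda>x. - D2 x" by (rule C2_fun_uminus)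
  have "laplacian (\<lambda>x. - u x) x = 0" for x
    using harm[of x] unfolding m.laplacian_u laplacian_u by (simp add: uminus_blinfun.rep_eq sum_negf)
  then have "- u x \<ge> - b" using m.harmonic_ge_exterior_value[of R "- b"] out by auto
  moreover have "u x \<ge> b" using harmonic_ge_exterior_value[of R b] assms by auto
  ultimately show ?thesis by simp
qed

end

section \<open>Behaviour at infinity\<close>

lemma powr_neg_small:
  fixes \<alpha> M \<epsilon> :: real
  assumes "\<alpha> > 0" "\<epsilon> > 0"
  shows "\<exists>K>0. \<forall>s\<ge>K. M * s powr (-\<alpha>) < \<epsilon>"
proof -
  have "((\<lambda>s. M * s powr (-\<alpha>)) \<longlongrightarrow> M * 0) at_top"
    using assms by (intro tendsto_mult_left tendsto_neg_powr filterlim_ident) auto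
  then have "eventually (\<lambda>s. M * s powr (-\<alpha>) < \<epsilon>) at_top"
    using assms(2) by (intro order_tendstoD(2)) auto
  then obtain K where "\<And>s. s \<ge> K \<Longrightarrow> M * s powr (-\<alpha>) < \<epsilon>"
    unfolding eventually_at_top_linorder by blast
  then show ?thesis by (intro exI[of _ "max K 1"]) auto
qed

lemma le_norm_power2:
  assumes "norm x \<ge> max 1 K" shows "(norm x)\<^sup>2 \<ge> K"
proof -
  have "norm x * 1 \<le> norm x * norm x" using assms by (intro mult_left_mono) auto
  then show ?thesis using assms by (simp add: power2_eq_square)
qed

section \<open>Attraction to the upper zero, and the lower bound in the plane\<close>

context C2_fun
begin

text \<open>Suppose \<open>u x\<close> is at most \<open>b - \<epsilon>\<close> far out. A
  paraboloid of Laplacian -k/2, opening downwards from \<open>x\<close>, is raised until it touches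
  \<open>u\<close> from below. It touches at a point where \<open>u\<close> is still at most
  \<open>b - \<epsilon>\<close>, and there the equation forces a Laplacian of at most -k.\<close>

lemma eventually_near_upper_zero:
  fixes g :: "real \<Rightarrow> real"
  assumes g: "continuous_on {m..b} g" "\<And>s. m \<le> s \<Longrightarrow> s < b \<Longrightarrow> g s < 0"
    and lap: "\<And>x. norm x \<ge> R \<Longrightarrow> laplacian u x = g (u x)"
    and bnd: "\<And>x. norm x \<ge> R \<Longrightarrow> m \<le> u x \<and> u x \<le> b"
    and e: "\<epsilon> > 0"
  shows "\<exists>K. \<forall>x. norm x \<ge> K \<longrightarrow> b - \<epsilon> < u x"
proof (cases "m \<le> b - \<epsilon>")
  case False
  then show ?thesis using bnd by (intro exI[of _ R]) force
next
  case True
  let ?n = "real CARD('n)"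
  have n: "?n > 0" by simp
  obtain t where t: "t \<in> {m..b - \<epsilon>}" "\<And>s. s \<in> {m..b - \<epsilon>} \<Longrightarrow> g s \<le> g t"
  proof -
    have "continuous_on {m..b - \<epsilon>} g" using e by (intro continuous_on_subset[OF g(1)]) auto
    then show thesis using continuous_attains_sup[of "{m..b - \<epsilon>}" g] True that by auto
  qed
  define k where "k = - g t"
  have k: "k > 0" "\<And>s. m \<le> s \<Longrightarrow> s \<le> b - \<epsilon> \<Longrightarrow> g s \<le> - k"
    using t g(2) e by (auto simp: k_def)
  \<comment> \<open>Over this radius the paraboloid drops by more than \<open>b - m\<close>, so the
    contact is interior. The summand 1 gives \<open>\<rho> > 1\<close>, hence a square no smaller
    than \<open>\<rho>\<close>, which avoids a square root.\<close>
  define \<rho> where "\<rho> = 1 + (b - m) * 4 * ?n / k"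
  have bm: "b - m > 0" using True e by linarith
  then have "(b - m) * 4 * ?n / k > 0" using k n by simp
  then have \<rho>: "\<rho> > 1" by (simp add: \<rho>_def)
  have "\<rho> * 1 \<le> \<rho>\<^sup>2" unfolding power2_eq_square using \<rho> by (intro mult_left_mono) auto
  then have "\<rho>\<^sup>2 > (b - m) * 4 * ?n / k" by (simp add: \<rho>_def)
  then have \<rho>2: "k / (4 * ?n) * \<rho>\<^sup>2 > b - m" using k n by (simp add: field_simps)
  show ?thesis
  proof (intro exI[of _ "R + \<rho>"] allI impI, rule ccontr)
    fix x :: "real^'n" assume x: "R + \<rho> \<le> norm x" and "\<not> b - \<epsilon> < u x"
    then have ux: "u x \<le> b - \<epsilon>" by simp
    define h where "h z = u z - - k / (4 * ?n) * (norm (z - x))\<^sup>2" for z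
    have "continuous_on (cball x \<rho>) h" unfolding h_def by (intro continuous_intros cont_u)
    obtain y where y: "y \<in> cball x \<rho>" "\<And>z. z \<in> cball x \<rho> \<Longrightarrow> h y \<le> h z"
      using continuous_attains_inf[OF compact_cball _ \<open>continuous_on (cball x \<rho>) h\<close>] \<rho> by auto
    have "h y \<le> h x" using y(2) \<rho> by simp
    then have hy: "u y + k / (4 * ?n) * (norm (y - x))\<^sup>2 \<le> b - \<epsilon>" using ux by (simp add: h_def)
    have yR: "norm y \<ge> R"
      using y(1) x norm_triangle_ineq2[of x y] by (simp add: dist_norm)
    have "norm (y - x) \<noteq> \<rho>"
      using hy \<rho>2 bnd[OF yR] e by auto
    then have yint: "dist y x < \<rho>" using y(1) by (simp add: dist_norm norm_minus_commute)
    have "laplacian u y \<ge> 4 * (norm (y - x))\<^sup>2 * 0 + 2 * real CARD('n) * (- k / (4 * ?n))"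
    proof (rule laplacian_at_touching_min[of "\<rho> - dist y x" y x "\<lambda>s. - k / (4 * ?n) * s" "\<lambda>_. - k / (4 * ?n)" 0])
      show "\<rho> - dist y x > 0" using yint by simp
      show "((*) (- k / (4 * ?n)) has_real_derivative - k / (4 * ?n)) (at s)" for s
        by (auto intro!: derivative_eq_intros)
      show "u y - - k / (4 * ?n) * (norm (y - x))\<^sup>2 \<le> u z - - k / (4 * ?n) * (norm (z - x))\<^sup>2"
        if "dist z y < \<rho> - dist y x" for z
      proof -
        have "z \<in> cball x \<rho>" using that dist_triangle[of z x y] by (simp add: dist_commute)
        then show ?thesis using y(2) by (simp add: h_def)
      qed
    qed auto
    moreover have "u y \<le> b - \<epsilon>"
      using hy k n by (smt (verit) divide_nonneg_pos mult_nonneg_nonneg zero_le_power2)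
    ultimately have "- k \<ge> 2 * ?n * (- k / (4 * ?n))" using k(2)[of "u y"] lap[OF yR] bnd[OF yR] by simp
    then show False using k n by (simp add: field_simps)
  qed
qed

lemma sphere_min:
  assumes "R > 0"
  obtains y where "norm y = R" "\<And>x. norm x = R \<Longrightarrow> u y \<le> u x"
proof -
  have "compact (sphere (0::real^'n) R)" "sphere (0::real^'n) R \<noteq> {}" using assms by auto
  then obtain y where "y \<in> sphere 0 R" "\<And>x. x \<in> sphere 0 R \<Longrightarrow> u y \<le> u x"
    using continuous_attains_inf[OF _ _ cont_u, of "sphere 0 R"] by auto
  then show thesis using that by auto
qed

text \<open>Parabolicity of the plane: \<open>ln\<close> is an unbounded radial harmonic function.\<close>

lemma exterior_lower_bound_2d:
  fixes g :: "real \<Rightarrow> real"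
  assumes n: "CARD('n) = 2" and R: "R > 0"
    and g: "\<And>s. a < s \<Longrightarrow> s < b \<Longrightarrow> g s < 0"
    and lap: "\<And>x. norm x \<ge> R \<Longrightarrow> laplacian u x = g (u x)"
    and bnd: "\<And>x. norm x \<ge> R \<Longrightarrow> a < u x \<and> u x \<le> b"
  obtains m where "m > a" "\<And>x. norm x \<ge> R \<Longrightarrow> m \<le> u x"
proof -
  obtain y where y: "norm y = R" "\<And>x. norm x = R \<Longrightarrow> u y \<le> u x" using sphere_min[OF R] by blast
  define m where "m = u y"
  have m: "m > a" "m \<le> b" using bnd[of y] y by (auto simp: m_def)
  have main: "m - \<epsilon> * (ln ((norm x)\<^sup>2) - ln (R\<^sup>2)) \<le> u x" if e: "\<epsilon> > 0" and x: "norm x \<ge> R" for \<epsilon> x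
  proof (rule exterior_comparison[OF R x, where f = "\<lambda>s. m - \<epsilon> * (ln s - ln (R\<^sup>2))"
        and f' = "\<lambda>s. - \<epsilon> / s" and f'' = "\<lambda>s. \<epsilon> / s\<^sup>2"])
    have pos: "s > 0" if "s > R\<^sup>2" for s using that by (meson le_less_trans zero_le_power2)
    show "((\<lambda>s. m - \<epsilon> * (ln s - ln (R\<^sup>2))) has_real_derivative - \<epsilon> / s) (at s)" if "s > R\<^sup>2" for s
      using pos[OF that] by (auto intro!: derivative_eq_intros)
    show "((\<lambda>s. - \<epsilon> / s) has_real_derivative \<epsilon> / s\<^sup>2) (at s)" if "s > R\<^sup>2" for s
      using pos[OF that] by (auto intro!: derivative_eq_intros simp: power2_eq_square)
    show "continuous_on {R\<^sup>2..} (\<lambda>s. m - \<epsilon> * (ln s - ln (R\<^sup>2)))"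
    proof (intro continuous_intros)
      show "\<forall>s\<in>{R\<^sup>2..}. s \<noteq> 0" using R by (metis atLeast_iff not_le zero_less_power)
    qed
    show "m - \<epsilon> * (ln (R\<^sup>2) - ln (R\<^sup>2)) \<le> u x" if "norm x = R" for x
      using y(2)[OF that] by (simp add: m_def)
    show "\<exists>K. \<forall>x. norm x \<ge> K \<longrightarrow> m - \<epsilon> * (ln ((norm x)\<^sup>2) - ln (R\<^sup>2)) - \<delta> \<le> u x" if "\<delta> > 0" for \<delta>
    \<comment> \<open>From this radius on the logarithm has pushed the barrier down to
      \<open>a\<close> or below, and \<open>u\<close> is above \<open>a\<close>.\<close>
    proof (intro exI[of _ "max R (max 1 (exp (ln (R\<^sup>2) + (m - a) / \<epsilon>)))"] allI impI)
      fix x :: "real^'n" assume A: "max R (max 1 (exp (ln (R\<^sup>2) + (m - a) / \<epsilon>))) \<le> norm x"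
      then have "exp (ln (R\<^sup>2) + (m - a) / \<epsilon>) \<le> (norm x)\<^sup>2"
        using le_norm_power2[of "exp (ln (R\<^sup>2) + (m - a) / \<epsilon>)" x] by simp
      then have "ln (R\<^sup>2) + (m - a) / \<epsilon> \<le> ln ((norm x)\<^sup>2)"
        using A by (subst ln_ge_iff) auto
      then have "(m - a) \<le> \<epsilon> * (ln ((norm x)\<^sup>2) - ln (R\<^sup>2))" using e by (simp add: field_simps)
      then show "m - \<epsilon> * (ln ((norm x)\<^sup>2) - ln (R\<^sup>2)) - \<delta> \<le> u x"
        using bnd[of x] A that by auto
    qed
    fix x :: "real^'n" assume x: "norm x > R" and lt: "u x < m - \<epsilon> * (ln ((norm x)\<^sup>2) - ln (R\<^sup>2))"
    have sq: "(norm x)\<^sup>2 \<ge> R\<^sup>2" "R\<^sup>2 > 0" using x R by (auto intro!: power_mono)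
    then have "ln ((norm x)\<^sup>2) \<ge> ln (R\<^sup>2)" by (subst ln_le_cancel_iff) auto
    then have "u x < b" using lt e m by (smt (verit) mult_nonneg_nonneg)
    then have "laplacian u x < 0" using lap[of x] g bnd[of x] x by simp
    also have "0 = 4 * (norm x)\<^sup>2 * (\<epsilon> / ((norm x)\<^sup>2)\<^sup>2) + 2 * real CARD('n) * (- \<epsilon> / (norm x)\<^sup>2)"
      using n sq by (simp add: power2_eq_square field_simps)
    finally show "laplacian u x < 4 * (norm x)\<^sup>2 * (\<epsilon> / ((norm x)\<^sup>2)\<^sup>2) + 2 * real CARD('n) * (- \<epsilon> / (norm x)\<^sup>2)" .
  qed
  have "m \<le> u x" if x: "norm x \<ge> R" for x
  proof -
    define L where "L = ln ((norm x)\<^sup>2) - ln (R\<^sup>2)"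
    have "R\<^sup>2 \<le> (norm x)\<^sup>2" "R\<^sup>2 > 0" using x R by (auto intro!: power_mono)
    then have L: "L \<ge> 0" unfolding L_def by (subst diff_ge_0_iff_ge, subst ln_le_cancel_iff) auto
    show ?thesis
    proof (rule ccontr)
      assume "\<not> m \<le> u x"
      \<comment> \<open>This positive number is used as \<open>\<epsilon>\<close> in
        \<open>main\<close>. It replaces the limit \<open>\<epsilon>\<close> to 0: the deficit
        \<open>m - u x\<close> would be at most L/(L+1) times itself.\<close>
      then have *: "(m - u x) / (L + 1) > 0" using L by simp
      have "m - u x \<le> (m - u x) / (L + 1) * L"
        using main[OF * x] by (simp add: L_def)
      also have "\<dots> < (m - u x) / (L + 1) * (L + 1)" using * by (intro mult_strict_left_mono) auto
      also have "\<dots> = m - u x" using L by simp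
      finally show False by simp
    qed
  qed
  then show thesis using that m by blast
qed

end

section \<open>Lower bound at infinity in dimension at least three\<close>

lemma powr_step: "s powr c = s * s powr d" if "s > 0" "d = c - 1" for s :: real
  using that by (simp add: powr_diff)

context C2_fun
begin

text \<open>The term with coefficient \<open>A\<close> is a multiple of the solution of
  \<open>\<Delta>\<psi> = -2n r\<^sup>2 \<bar>x\<bar>\<^bsup>-n-2\<^esup>\<close> that vanishes at \<open>\<bar>x\<bar> = r\<close> and at infinity; the source is
  dominated by the reaction term evaluated at the lower barrier \<open>N \<bar>x\<bar>\<^bsup>2-n\<^esup>\<close>.\<close>

lemma exterior_barrier:
  fixes g :: "real \<Rightarrow> real"
  defines "\<alpha> \<equiv> (real CARD('n) - 2) / 2"
  assumes n: "CARD('n) \<ge> 3" and r: "r > 0" and N: "N > 0" and A: "A \<ge> 0"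
    and lap: "\<And>x. norm x \<ge> r \<Longrightarrow> laplacian u x = g (u x)"
    and bnd: "\<And>x. norm x \<ge> r \<Longrightarrow> a < u x"
    and sphere: "\<And>x. norm x = r \<Longrightarrow> a + N * (r\<^sup>2) powr (-\<alpha>) \<le> u x"
    and g: "\<And>x. norm x > r \<Longrightarrow> u x < a + (N + A) * (r\<^sup>2) powr (-\<alpha>) \<Longrightarrow>
        g (u x) < - 2 * real CARD('n) * A * (r\<^sup>2) * ((norm x)\<^sup>2) powr (-\<alpha> - 2)"
    and x: "norm x \<ge> r"
  shows "a + (N + A) * ((norm x)\<^sup>2) powr (-\<alpha>) - A * (r\<^sup>2) * ((norm x)\<^sup>2) powr (-\<alpha> - 1) \<le> u x"
proof (rule exterior_comparison[OF r x,
      where f = "\<lambda>s. a + (N + A) * s powr (-\<alpha>) - A * (r\<^sup>2) * s powr (-\<alpha> - 1)"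
        and f' = "\<lambda>s. - \<alpha> * (N + A) * s powr (-\<alpha> - 1) + (\<alpha> + 1) * A * (r\<^sup>2) * s powr (-\<alpha> - 2)"
        and f'' = "\<lambda>s. \<alpha> * (\<alpha> + 1) * (N + A) * s powr (-\<alpha> - 2) - (\<alpha> + 1) * (\<alpha> + 2) * A * (r\<^sup>2) * s powr (-\<alpha> - 3)"])
  have n\<alpha>: "real CARD('n) = 2 * \<alpha> + 2" by (simp add: \<alpha>_def field_simps)
  have \<alpha>: "\<alpha> > 0" using n by (simp add: \<alpha>_def)
  have r2: "r\<^sup>2 > 0" using r by simp
  have pos: "s > 0" if "s > r\<^sup>2" for s using that by (meson le_less_trans zero_le_power2)
  have D: "((\<lambda>s. s powr c) has_real_derivative c * s powr d) (at s)" if "s > r\<^sup>2" "d = c - 1" for c d s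
    using has_real_derivative_powr[OF pos[OF that(1)], of c] that(2) by simp
  show "((\<lambda>s. a + (N + A) * s powr (-\<alpha>) - A * (r\<^sup>2) * s powr (-\<alpha> - 1)) has_real_derivative
      - \<alpha> * (N + A) * s powr (-\<alpha> - 1) + (\<alpha> + 1) * A * (r\<^sup>2) * s powr (-\<alpha> - 2)) (at s)" if "s > r\<^sup>2" for s
    by (rule DERIV_cong[OF DERIV_diff[OF DERIV_add[OF DERIV_const DERIV_cmult[OF D[OF that, of "-\<alpha> - 1"]]]
            DERIV_cmult[OF D[OF that, of "-\<alpha> - 2"]]]]) (simp_all add: algebra_simps)
  show "((\<lambda>s. - \<alpha> * (N + A) * s powr (-\<alpha> - 1) + (\<alpha> + 1) * A * (r\<^sup>2) * s powr (-\<alpha> - 2)) has_real_derivative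
      \<alpha> * (\<alpha> + 1) * (N + A) * s powr (-\<alpha> - 2) - (\<alpha> + 1) * (\<alpha> + 2) * A * (r\<^sup>2) * s powr (-\<alpha> - 3)) (at s)"
    if "s > r\<^sup>2" for s
    by (rule DERIV_cong[OF DERIV_add[OF DERIV_cmult[OF D[OF that, of "-\<alpha> - 2"]]
            DERIV_cmult[OF D[OF that, of "-\<alpha> - 3"]]]]) (simp_all add: algebra_simps)
  show "continuous_on {r\<^sup>2..} (\<lambda>s. a + (N + A) * s powr (-\<alpha>) - A * (r\<^sup>2) * s powr (-\<alpha> - 1))"
  proof (intro continuous_intros)
    show "\<forall>s\<in>{r\<^sup>2..}. s \<noteq> 0" "\<forall>s\<in>{r\<^sup>2..}. s \<noteq> 0" using r2 by auto
  qed
  have drop: "A * (r\<^sup>2) * s powr (-\<alpha> - 1) \<ge> 0" for s using A by simp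
  \<comment> \<open>On the sphere of radius \<open>r\<close> the two terms with coefficient
    \<open>A\<close> cancel, so only the bound with \<open>N\<close> is needed there.\<close>
  show "a + (N + A) * (r\<^sup>2) powr (-\<alpha>) - A * (r\<^sup>2) * (r\<^sup>2) powr (-\<alpha> - 1) \<le> u x" if "norm x = r" for x
  proof -
    have "(r\<^sup>2) * (r\<^sup>2) powr (-\<alpha> - 1) = (r\<^sup>2) powr (-\<alpha>)"
      using r2 by (simp add: powr_diff)
    then have "A * (r\<^sup>2) * (r\<^sup>2) powr (-\<alpha> - 1) = A * (r\<^sup>2) powr (-\<alpha>)" by (simp only: mult.assoc)
    then have "a + (N + A) * (r\<^sup>2) powr (-\<alpha>) - A * (r\<^sup>2) * (r\<^sup>2) powr (-\<alpha> - 1) = a + N * (r\<^sup>2) powr (-\<alpha>)"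
      by (simp only:) (simp add: algebra_simps)
    then show ?thesis using sphere[OF that] by linarith
  qed
  show "\<exists>K. \<forall>x. norm x \<ge> K \<longrightarrow>
      a + (N + A) * ((norm x)\<^sup>2) powr (-\<alpha>) - A * (r\<^sup>2) * ((norm x)\<^sup>2) powr (-\<alpha> - 1) - \<epsilon> \<le> u x"
    if \<epsilon>: "\<epsilon> > 0" for \<epsilon>
  proof -
    obtain K where K: "\<And>s. s \<ge> K \<Longrightarrow> (N + A) * s powr (-\<alpha>) < \<epsilon>"
      using powr_neg_small[OF \<alpha> \<epsilon>] by blast
    show ?thesis
    proof (intro exI[of _ "max r (max 1 K)"] allI impI)
      fix x :: "real^'n" assume x: "max r (max 1 K) \<le> norm x"
      then have "(N + A) * ((norm x)\<^sup>2) powr (-\<alpha>) < \<epsilon>" using le_norm_power2[of K x] K by simp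
      then show "a + (N + A) * ((norm x)\<^sup>2) powr (-\<alpha>) - A * (r\<^sup>2) * ((norm x)\<^sup>2) powr (-\<alpha> - 1) - \<epsilon> \<le> u x"
        using drop[of "(norm x)\<^sup>2"] bnd[of x] x by simp
    qed
  qed
  fix x :: "real^'n"
  define s where "s = (norm x)\<^sup>2"
  assume x: "norm x > r"
    and lt: "u x < a + (N + A) * ((norm x)\<^sup>2) powr (-\<alpha>) - A * (r\<^sup>2) * ((norm x)\<^sup>2) powr (-\<alpha> - 1)"
  have s: "s > r\<^sup>2" unfolding s_def using x r by (intro power_strict_mono) auto
  have "s powr (-\<alpha>) \<le> (r\<^sup>2) powr (-\<alpha>)" using s r2 \<alpha> by (intro powr_mono2') auto
  then have "(N + A) * s powr (-\<alpha>) \<le> (N + A) * (r\<^sup>2) powr (-\<alpha>)" using N A by (intro mult_left_mono) auto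
  then have "u x < a + (N + A) * (r\<^sup>2) powr (-\<alpha>)" using lt drop[of s] by (simp add: s_def)
  then have "g (u x) < - 2 * real CARD('n) * A * (r\<^sup>2) * s powr (-\<alpha> - 2)"
    unfolding s_def using g[OF x] by simp
  \<comment> \<open>The part with exponent \<open>-\<alpha>\<close> is harmonic. The other one
    contributes the factor (\<alpha> + 1) (2 n - 4 (\<alpha> + 2)) = -4 (\<alpha> + 1) = -2 n, since
    n = 2 \<alpha> + 2.\<close>
  also have "\<dots> = 4 * s * (\<alpha> * (\<alpha> + 1) * (N + A) * s powr (-\<alpha> - 2) - (\<alpha> + 1) * (\<alpha> + 2) * A * (r\<^sup>2) * s powr (-\<alpha> - 3))
     + 2 * real CARD('n) * (- \<alpha> * (N + A) * s powr (-\<alpha> - 1) + (\<alpha> + 1) * A * (r\<^sup>2) * s powr (-\<alpha> - 2))"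
  proof -
    have 1: "s powr (-\<alpha> - 1) = s * s powr (-\<alpha> - 2)" "s powr (-\<alpha> - 2) = s * s powr (-\<alpha> - 3)"
      by (rule powr_step[OF pos[OF s]]; simp)+
    show ?thesis unfolding n\<alpha> 1 by (simp add: algebra_simps)
  qed
  finally show "laplacian u x < 4 * (norm x)\<^sup>2 * (\<alpha> * (\<alpha> + 1) * (N + A) * ((norm x)\<^sup>2) powr (-\<alpha> - 2)
        - (\<alpha> + 1) * (\<alpha> + 2) * A * (r\<^sup>2) * ((norm x)\<^sup>2) powr (-\<alpha> - 3))
     + 2 * real CARD('n) * (- \<alpha> * (N + A) * ((norm x)\<^sup>2) powr (-\<alpha> - 1)
        + (\<alpha> + 1) * A * (r\<^sup>2) * ((norm x)\<^sup>2) powr (-\<alpha> - 2))"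
    using lap[of x] x by (simp add: s_def)
qed


text \<open>Phase one raises the coefficient L in u >= a + L |x|^(2-n) by a fixed amount per
  comparison, as far as desired. Phase two fixes one large L. For N >= L the reaction N^p beats the
  required multiple of N, so the barrier started at |x| = r regains at |x| = 2 r what the factor
  2^(2-n) loses, and a constant bound \<open>a + z\<close> passes from sphere to sphere.\<close>

lemma exterior_lower_bound_ge3:
  fixes g :: "real \<Rightarrow> real"
  assumes n: "CARD('n) \<ge> 3" and R: "R > 0"
    and g: "\<And>s. a < s \<Longrightarrow> s < b \<Longrightarrow> g s < 0"
    and C\<^sub>0: "C\<^sub>0 > 0" and s\<^sub>0: "a < s\<^sub>0" "s\<^sub>0 < b"
    and crit: "\<And>s. a \<le> s \<Longrightarrow> s \<le> s\<^sub>0 \<Longrightarrow>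
        g s \<le> - C\<^sub>0 * (s - a) powr (real CARD('n) / (real CARD('n) - 2))"
    and lap: "\<And>x. norm x \<ge> R \<Longrightarrow> laplacian u x = g (u x)"
    and bnd: "\<And>x. norm x \<ge> R \<Longrightarrow> a < u x \<and> u x \<le> b"
  obtains m r where "m > a" "r \<ge> R" "\<And>x. norm x \<ge> r \<Longrightarrow> m \<le> u x"
proof -
  let ?n = "real CARD('n)"
  define \<alpha> where "\<alpha> = (?n - 2) / 2"
  define p where "p = ?n / (?n - 2)"
  have \<alpha>: "\<alpha> > 0" and n\<alpha>: "?n = 2 * \<alpha> + 2" using n by (simp_all add: \<alpha>_def field_simps)
  \<comment> \<open>The identity \<open>\<alpha>p\<close> expresses criticality: inserting N
    |x|^(2-n) into the power p gives N^p |x|^(-n).\<close>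
  have p1: "p > 1" and \<alpha>p: "\<alpha> * p = \<alpha> + 1" using n by (simp_all add: \<alpha>_def p_def field_simps)
  define q where "q x = ((norm (x::real^'n))\<^sup>2) powr (-\<alpha>)" for x
  have q0: "q x \<ge> 0" for x by (simp add: q_def)
  \<comment> \<open>superharmonicity alone propagates the bound from a sphere to its exterior\<close>
  have step0: "a + N * q x \<le> u x"
    if r: "r \<ge> R" and N: "N > 0" and sphere: "\<And>x. norm x = r \<Longrightarrow> a + N * (r\<^sup>2) powr (-\<alpha>) \<le> u x"
      and x: "norm x \<ge> r" for r N x
  proof -
    have rpos: "r > 0" using r R by simp
    \<comment> \<open>A point on the sphere witnesses that the initial height of the barrier is at
      most \<open>b\<close>; where \<open>u\<close> is lower it is below \<open>b\<close>, and
      \<open>g\<close> is negative.\<close>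
    obtain y :: "real^'n" where y: "norm y = r" using vector_choose_size[of r] rpos less_imp_le by blast
    have "a + (N + 0) * ((norm x)\<^sup>2) powr (- ((?n - 2) / 2)) - 0 * (r\<^sup>2) * ((norm x)\<^sup>2) powr (- ((?n - 2) / 2) - 1) \<le> u x"
    proof (rule exterior_barrier[where g = g and r = r and a = a and N = N and A = 0 and x = x])
      show "3 \<le> CARD('n)" "0 < r" "0 < N" "r \<le> norm x" "0 \<le> (0::real)" using n rpos N x by auto
      show "laplacian u x = g (u x)" "a < u x" if "norm x \<ge> r" for x using that r lap bnd by auto
      show "a + N * (r\<^sup>2) powr - ((?n - 2) / 2) \<le> u x" if "norm x = r" for x
        using sphere[OF that] by (simp add: \<alpha>_def)
      fix x :: "real^'n"
      assume "norm x > r" "u x < a + (N + 0) * (r\<^sup>2) powr - ((?n - 2) / 2)"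
      then show "g (u x) < - 2 * ?n * 0 * (r\<^sup>2) * ((norm x)\<^sup>2) powr (- ((?n - 2) / 2) - 2)"
        using sphere[OF y] bnd[of y] bnd[of x] y r g[of "u x"] by (simp add: \<alpha>_def)
    qed
    then show ?thesis by (simp add: q_def \<alpha>_def)
  qed
  \<comment> \<open>By \<open>step0\<close> the reaction is at least
    \<open>C\<^sub>0 * N powr p\<close> times |x|^(-n). It dominates the source 2 n A r^2 |x|^(-n-2)
    because |x| > r. The assumption \<open>small\<close> keeps \<open>u\<close> in the range of
    \<open>crit\<close> wherever it has to be tested.\<close>
  have step: "a + (N + A) * q x - A * (r\<^sup>2 / (norm x)\<^sup>2) * q x \<le> u x"
    if r: "r \<ge> R" and N: "N > 0" and A: "A \<ge> 0" "2 * ?n * A \<le> C\<^sub>0 * N powr p"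
      and small: "(N + A) * (r\<^sup>2) powr (-\<alpha>) \<le> s\<^sub>0 - a"
      and sphere: "\<And>x. norm x = r \<Longrightarrow> a + N * (r\<^sup>2) powr (-\<alpha>) \<le> u x"
      and x: "norm x \<ge> r" for r N A x
  proof -
    have rpos: "r > 0" using r R by simp
    have "a + (N + A) * ((norm x)\<^sup>2) powr (- ((?n - 2) / 2)) - A * (r\<^sup>2) * ((norm x)\<^sup>2) powr (- ((?n - 2) / 2) - 1) \<le> u x"
    proof (rule exterior_barrier[where g = g and r = r and a = a and N = N and A = A and x = x])
      show "3 \<le> CARD('n)" "0 < r" "0 < N" "r \<le> norm x" "0 \<le> A" using n rpos N x A by auto
      show "laplacian u x = g (u x)" "a < u x" if "norm x \<ge> r" for x using that r lap bnd by auto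
      show "a + N * (r\<^sup>2) powr - ((?n - 2) / 2) \<le> u x" if "norm x = r" for x
        using sphere[OF that] by (simp add: \<alpha>_def)
      fix x :: "real^'n"
      assume x: "norm x > r" and lt: "u x < a + (N + A) * (r\<^sup>2) powr - ((?n - 2) / 2)"
      define s where "s = (norm x)\<^sup>2"
      have s: "s > r\<^sup>2" "s > 0" unfolding s_def using x rpos by (auto intro!: power_strict_mono)
      have low: "a + N * q x \<le> u x" using step0[OF r N sphere] x by simp
      have "u x \<le> s\<^sub>0" using lt small by (simp add: \<alpha>_def)
      moreover have "a < u x" using bnd[of x] x r by simp
      ultimately have "g (u x) \<le> - C\<^sub>0 * (u x - a) powr p" unfolding p_def by (intro crit) auto
      moreover have "(u x - a) powr p \<ge> (N * q x) powr p"
        using low N q0[of x] p1 by (intro powr_mono2) auto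
      then have "C\<^sub>0 * (u x - a) powr p \<ge> C\<^sub>0 * (N * q x) powr p" using C\<^sub>0 by (intro mult_left_mono) auto
      moreover have "(N * q x) powr p = N powr p * s powr (-\<alpha> - 1)"
        using N \<alpha>p by (simp add: q_def s_def powr_mult powr_powr)
      ultimately have "g (u x) \<le> - (C\<^sub>0 * N powr p * s powr (-\<alpha> - 1))" by (simp add: algebra_simps)
      also have "\<dots> = - (C\<^sub>0 * N powr p * s * s powr (-\<alpha> - 2))"
      proof -
        have "s powr (-\<alpha> - 1) = s * s powr (-\<alpha> - 2)" by (rule powr_step[OF s(2)]) simp
        then show ?thesis by simp
      qed
      also have "\<dots> < - (2 * ?n * A * r\<^sup>2 * s powr (-\<alpha> - 2))"
      proof -
        have "2 * ?n * A * r\<^sup>2 \<le> C\<^sub>0 * N powr p * r\<^sup>2" using A by (intro mult_right_mono) auto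
        also have "\<dots> < C\<^sub>0 * N powr p * s" using s C\<^sub>0 N by (intro mult_strict_left_mono) auto
        finally show ?thesis using s by (simp add: mult_strict_right_mono)
      qed
      finally show "g (u x) < - 2 * ?n * A * (r\<^sup>2) * ((norm x)\<^sup>2) powr (- ((?n - 2) / 2) - 2)"
        by (simp add: s_def \<alpha>_def)
    qed
    moreover have "((norm x)\<^sup>2) powr (-\<alpha> - 1) = q x / (norm x)\<^sup>2"
      using x rpos by (simp add: q_def powr_diff)
    ultimately show ?thesis by (simp add: q_def \<alpha>_def)
  qed
  define P where "P L \<longleftrightarrow> (\<exists>r\<ge>R. \<forall>x. norm x \<ge> r \<longrightarrow> a + L * q x \<le> u x)" for L
  obtain L\<^sub>0 where L\<^sub>0: "L\<^sub>0 > 0" "P L\<^sub>0"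
  proof -
    obtain y where y: "norm y = R" "\<And>x. norm x = R \<Longrightarrow> u y \<le> u x" using sphere_min[OF R] by blast
    define N where "N = (u y - a) / (R\<^sup>2) powr (-\<alpha>)"
    have "N > 0" "N * (R\<^sup>2) powr (-\<alpha>) = u y - a" using bnd[of y] y R by (auto simp: N_def)
    then have "P N" unfolding P_def using step0[of R N] y by (intro exI[of _ R]) auto
    then show thesis using that \<open>N > 0\<close> by blast
  qed
  have P_mono: "P L" if "P L'" "L \<le> L'" for L L'
    using that unfolding P_def by (meson add_left_mono mult_right_mono order_trans q0)
  \<comment> \<open>This is the largest gain allowed at the initial coefficient. Larger coefficients
    allow at least as much, so the gains do not shrink and their sum is unbounded.\<close>
  define A\<^sub>0 where "A\<^sub>0 = C\<^sub>0 * L\<^sub>0 powr p / (2 * ?n)"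
  have A\<^sub>0: "A\<^sub>0 > 0" using C\<^sub>0 L\<^sub>0 by (simp add: A\<^sub>0_def)
  have eventually_small: "\<exists>r'\<ge>r. \<forall>\<rho>\<ge>r'. M * (\<rho>\<^sup>2) powr (-\<alpha>) \<le> \<epsilon>" if e: "\<epsilon> > 0" for M \<epsilon> r :: real
  proof -
    obtain K where K: "\<And>s. s \<ge> K \<Longrightarrow> M * s powr (-\<alpha>) < \<epsilon>" using powr_neg_small[OF \<alpha> e] by blast
    have "M * (\<rho>\<^sup>2) powr (-\<alpha>) \<le> \<epsilon>" if "\<rho> \<ge> max r (max 1 K)" for \<rho>
    proof -
      have "\<rho>\<^sup>2 \<ge> K" using le_norm_power2[of K \<rho>] that by simp
      then show ?thesis using K by fastforce
    qed
    then show ?thesis by (intro exI[of _ "max r (max 1 K)"]) auto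
  qed
  \<comment> \<open>The comparison starts at a radius where the barrier is at most
    \<open>s\<^sub>0\<close>. Beyond twice that radius the correction term costs at most half of the
    gain.\<close>
  have P_step: "P (L + A\<^sub>0 / 2)" if L: "P L" "L \<ge> L\<^sub>0" for L
  proof -
    obtain r\<^sub>1 where r\<^sub>1: "r\<^sub>1 \<ge> R" "\<And>x. norm x \<ge> r\<^sub>1 \<Longrightarrow> a + L * q x \<le> u x" using L P_def by blast
    obtain r where r: "r \<ge> r\<^sub>1" "(L + A\<^sub>0) * (r\<^sup>2) powr (-\<alpha>) \<le> s\<^sub>0 - a"
      using eventually_small[of "s\<^sub>0 - a"] s\<^sub>0 by (metis diff_gt_0_iff_gt order.refl)
    have rpos: "r > 0" "r \<ge> R" using r r\<^sub>1 R by auto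
    have "L\<^sub>0 powr p \<le> L powr p" using L L\<^sub>0 p1 by (intro powr_mono2) auto
    then have A: "2 * ?n * A\<^sub>0 \<le> C\<^sub>0 * L powr p" using C\<^sub>0 by (simp add: A\<^sub>0_def)
    have "a + (L + A\<^sub>0 / 2) * q x \<le> u x" if x: "norm x \<ge> 2 * r" for x
    proof -
      have "a + (L + A\<^sub>0) * q x - A\<^sub>0 * (r\<^sup>2 / (norm x)\<^sup>2) * q x \<le> u x"
      proof (rule step[OF _ _ _ A r(2)])
        show "a + L * (r\<^sup>2) powr (-\<alpha>) \<le> u z" if "norm z = r" for z
          using r\<^sub>1(2)[of z] r that by (simp add: q_def)
      qed (use rpos L L\<^sub>0 A\<^sub>0 x in auto)
      moreover have "r\<^sup>2 / (norm x)\<^sup>2 \<le> 1 / 2"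
      proof -
        have "(2 * r)\<^sup>2 \<le> (norm x)\<^sup>2" using x rpos by (intro power_mono) auto
        then have "4 * r\<^sup>2 \<le> (norm x)\<^sup>2" by (simp add: power_mult_distrib)
        then have "2 * r\<^sup>2 \<le> (norm x)\<^sup>2" using zero_le_power2[of r] by linarith
        moreover have "(norm x)\<^sup>2 > 0" using x rpos by auto
        ultimately show ?thesis by (simp add: field_simps)
      qed
      then have "A\<^sub>0 * (r\<^sup>2 / (norm x)\<^sup>2) * q x \<le> A\<^sub>0 * (1/2) * q x"
        using A\<^sub>0 q0 by (intro mult_right_mono mult_left_mono) auto
      moreover have "a + (L + A\<^sub>0 / 2) * q x = a + (L + A\<^sub>0) * q x - A\<^sub>0 * (1/2) * q x"
        by (simp add: algebra_simps)
      ultimately show ?thesis by linarith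
    qed
    then show ?thesis unfolding P_def using rpos by (intro exI[of _ "2 * r"]) auto
  qed
  have P_all: "P L" for L
  proof -
    have *: "P (L\<^sub>0 + real k * (A\<^sub>0 / 2))" for k
    proof (induction k)
      case (Suc k)
      have "L\<^sub>0 + real k * (A\<^sub>0 / 2) \<ge> L\<^sub>0" using A\<^sub>0 by simp
      moreover have "L\<^sub>0 + real k * (A\<^sub>0 / 2) + A\<^sub>0 / 2 = L\<^sub>0 + real (Suc k) * (A\<^sub>0 / 2)"
        by (simp add: field_simps)
      ultimately show ?case using P_step[OF Suc] by metis
    qed (use L\<^sub>0 in simp)
    obtain k :: nat where "real k > (L - L\<^sub>0) / (A\<^sub>0 / 2)" using reals_Archimedean2 by blast
    then have "L \<le> L\<^sub>0 + real k * (A\<^sub>0 / 2)" using A\<^sub>0 by (simp add: field_simps)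
    then show ?thesis using P_mono * by blast
  qed
  \<comment> \<open>\<open>T\<close> is 2^(n-2), the factor by which |x|^(2-n) shrinks when the
    radius doubles.\<close>
  define T where "T = 4 powr \<alpha>"
  have T: "T > 1" using \<alpha> by (simp add: T_def)
  define \<sigma> where "\<sigma> = s\<^sub>0 - a"
  have \<sigma>: "\<sigma> > 0" using s\<^sub>0 by (simp add: \<sigma>_def)
  \<comment> \<open>\<open>L\<close> solves 2 n (2 T) = C_0 L^(p-1); from there on the gain 2 T N is
    affordable, because p > 1.\<close>
  define L where "L = (2 * ?n * (2 * T) / C\<^sub>0) powr (1 / (p - 1))"
  have L: "L > 0" using T C\<^sub>0 by (simp add: L_def)
  have Lp: "2 * ?n * (2 * T * N) \<le> C\<^sub>0 * N powr p" if "N \<ge> L" for N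
  proof -
    have "2 * ?n * (2 * T) = C\<^sub>0 * L powr (p - 1)"
      using T C\<^sub>0 p1 by (simp add: L_def powr_powr)
    also have "\<dots> \<le> C\<^sub>0 * N powr (p - 1)" using that L C\<^sub>0 p1 by (intro mult_left_mono powr_mono2) auto
    finally have "2 * ?n * (2 * T) * N \<le> C\<^sub>0 * N powr (p - 1) * N" using that L by (intro mult_right_mono) auto
    also have "\<dots> = C\<^sub>0 * N powr p" using that L by (simp add: powr_diff)
    finally show ?thesis by (simp add: mult.assoc)
  qed
  obtain r\<^sub>0 where r\<^sub>0: "r\<^sub>0 \<ge> R" "\<And>x. norm x \<ge> r\<^sub>0 \<Longrightarrow> a + L * q x \<le> u x" using P_all P_def by blast
  obtain r\<^sub>1 where r\<^sub>1: "r\<^sub>1 \<ge> r\<^sub>0" "\<And>\<rho>. \<rho> \<ge> r\<^sub>1 \<Longrightarrow> L * (\<rho>\<^sup>2) powr (-\<alpha>) \<le> \<sigma> / 2"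
    using eventually_small[of "\<sigma> / 2" r\<^sub>0 L] \<sigma> by auto
  have r\<^sub>1pos: "r\<^sub>1 > 0" "r\<^sub>1 \<ge> R" using r\<^sub>0 r\<^sub>1 R by auto
  obtain z\<^sub>1 where z\<^sub>1: "z\<^sub>1 > 0" "\<And>x. r\<^sub>1 \<le> norm x \<Longrightarrow> norm x \<le> 2 * r\<^sub>1 \<Longrightarrow> a + z\<^sub>1 \<le> u x"
  proof -
    define S where "S = cball 0 (2 * r\<^sub>1) - ball (0::real^'n) r\<^sub>1"
    obtain y :: "real^'n" where y: "norm y = r\<^sub>1" using vector_choose_size[of r\<^sub>1] r\<^sub>1pos less_imp_le by blast
    have "y \<in> S" using y r\<^sub>1pos by (simp add: S_def)
    then have "S \<noteq> {}" by blast
    have "compact S" unfolding S_def by (intro compact_diff) auto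
    then obtain z where z: "z \<in> S" "\<And>x. x \<in> S \<Longrightarrow> u z \<le> u x"
      using continuous_attains_inf[OF \<open>compact S\<close> \<open>S \<noteq> {}\<close> cont_u] by auto
    show thesis
    proof (rule that[of "u z - a"])
      show "u z - a > 0" using z(1) bnd[of z] r\<^sub>1pos by (simp add: S_def)
      show "a + (u z - a) \<le> u x" if "r\<^sub>1 \<le> norm x" "norm x \<le> 2 * r\<^sub>1" for x
        using z(2)[of x] that by (simp add: S_def)
    qed
  qed
  \<comment> \<open>The first entry is the bound available on the initial annulus, the second is
    what a capped gain can restore in \<open>double\<close>.\<close>
  define z where "z = min z\<^sub>1 (\<sigma> / (4 * T))"
  have z: "z > 0" "z \<le> z\<^sub>1" "z \<le> \<sigma> / (4 * T)" using z\<^sub>1 \<sigma> T by (auto simp: z_def)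
  have z\<sigma>: "z \<le> \<sigma> / 2"
  proof -
    have "\<sigma> / (4 * T) \<le> \<sigma> / 2" using T \<sigma> by (intro divide_left_mono) auto
    then show ?thesis using z by simp
  qed
  have double: "a + z \<le> u x" if r: "r \<ge> r\<^sub>1" and sph: "\<And>y. norm y = r \<Longrightarrow> a + z \<le> u y" and x: "norm x = 2 * r"
    for r x
  proof -
    have rpos: "r > 0" "r \<ge> R" using r r\<^sub>1pos by auto
    define Q where "Q = (r\<^sup>2) powr (-\<alpha>)"
    have Q: "Q > 0" using rpos by (simp add: Q_def)
    \<comment> \<open>\<open>N\<close> combines the two bounds known on the sphere, u - a >= z and u
      - a >= L Q. \<open>A\<close> is the full gain 2 T N unless the cap intervenes; as N Q and A Q
      are at most \<sigma>/2, the barrier does not exceed \<open>s\<^sub>0\<close>.\<close>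
    define N where "N = max (z / Q) L"
    define A where "A = min (2 * T * N) (\<sigma> / (2 * Q))"
    have N: "N \<ge> L" "N > 0" "N * Q \<ge> z" using L Q z(1) by (auto simp: N_def max_def field_simps)
    have NQ: "N * Q \<le> \<sigma> / 2"
      using z\<sigma> r\<^sub>1(2)[OF r] Q by (auto simp: N_def max_def Q_def)
    have A: "A \<ge> 0" "A * Q \<le> \<sigma> / 2" using T N \<sigma> Q by (auto simp: A_def min_def field_simps)
    have "2 * ?n * A \<le> 2 * ?n * (2 * T * N)" by (intro mult_left_mono) (auto simp: A_def)
    then have A2: "2 * ?n * A \<le> C\<^sub>0 * N powr p" using Lp[OF N(1)] by linarith
    have bar: "a + (N + A) * q x - A * (r\<^sup>2 / (norm x)\<^sup>2) * q x \<le> u x"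
    proof (rule step[OF rpos(2) N(2) A(1) A2])
      show "(N + A) * (r\<^sup>2) powr (-\<alpha>) \<le> s\<^sub>0 - a"
        using NQ A(2) by (simp add: Q_def \<sigma>_def algebra_simps)
      show "a + N * (r\<^sup>2) powr (-\<alpha>) \<le> u y" if "norm y = r" for y
        using sph[OF that] r\<^sub>0(2)[of y] that r r\<^sub>1 Q by (auto simp: N_def max_def Q_def q_def)
      show "r \<le> norm x" using x rpos by simp
    qed
    have ratio: "r\<^sup>2 / (norm x)\<^sup>2 = 1 / 4" using x rpos by (simp add: power_mult_distrib)
    have qx: "q x = Q / T"
      using rpos by (simp add: q_def x Q_def T_def power_mult_distrib powr_mult powr_minus field_simps)
    have "a + N * (Q / T) + 3 / 4 * (A * Q) / T = a + (N + A) * (Q / T) - A * (1 / 4) * (Q / T)"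
      using T by (simp add: field_simps)
    with bar have "a + N * (Q / T) + 3 / 4 * (A * Q) / T \<le> u x" unfolding ratio qx by linarith
    moreover have "N * (Q / T) \<ge> 0" using N Q T by simp
    \<comment> \<open>A full gain leaves 3/2 N Q >= 3/2 z at the doubled radius; a capped one leaves
      3/2 times \<sigma>/(4 T), which is again at least 3/2 z.\<close>
    moreover have "z \<le> 3 / 4 * (A * Q) / T \<or> z \<le> N * (Q / T) + 3 / 4 * (A * Q) / T"
    proof (cases "2 * T * N \<le> \<sigma> / (2 * Q)")
      case True
      then have "3 / 4 * (A * Q) / T = 3 / 2 * (N * Q)" using T by (simp add: A_def)
      then show ?thesis using N z by simp
    next
      case False
      then have "A * Q = \<sigma> / 2" using Q by (simp add: A_def)
      then have "3 / 4 * (A * Q) / T = 3 / 2 * (\<sigma> / (4 * T))" by (simp only:)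
      then show ?thesis using z by linarith
    qed
    ultimately show ?thesis by linarith
  qed
  \<comment> \<open>Compactness covers the first dyadic annulus; any point further out is reached
    from the sphere of half its norm.\<close>
  have all: "a + z \<le> u x" if "r\<^sub>1 \<le> norm x" "norm x \<le> 2 ^ (k + 1) * r\<^sub>1" for k x
    using that
  proof (induction k arbitrary: x)
    case 0
    then show ?case using z\<^sub>1(2)[of x] z by simp
  next
    case (Suc k)
    show ?case
    proof (cases "norm x \<le> 2 * r\<^sub>1")
      case True
      then show ?thesis using z\<^sub>1(2)[of x] z Suc.prems by simp
    next
      case False
      show ?thesis
      proof (rule double[of "norm x / 2"])
        show "r\<^sub>1 \<le> norm x / 2" "norm x = 2 * (norm x / 2)" using False by auto
        show "a + z \<le> u y" if "norm y = norm x / 2" for y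
          using that False Suc.prems by (intro Suc.IH) auto
      qed
    qed
  qed
  have "a + z \<le> u x" if "norm x \<ge> r\<^sub>1" for x
  proof -
    obtain k where "norm x / r\<^sub>1 < 2 ^ k" using real_arch_pow[of 2 "norm x / r\<^sub>1"] by auto
    then have "norm x < 2 ^ k * r\<^sub>1" using r\<^sub>1pos by (simp add: field_simps)
    also have "\<dots> \<le> 2 ^ (k + 1) * r\<^sub>1" using r\<^sub>1pos by simp
    finally show ?thesis using all[of x k] that by simp
  qed
  then show thesis using that[of "a + z" r\<^sub>1] z r\<^sub>1pos by auto
qed

end

section \<open>Integration by parts\<close>

lemma continuous_compact_support_integrable:
  fixes f :: "'a::euclidean_space \<Rightarrow> real"
  assumes "continuous_on UNIV f" "\<And>x. norm x \<ge> K \<Longrightarrow> f x = 0"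
  shows "integrable lborel f"
proof -
  have "integrable lborel (\<lambda>x. indicator (cball 0 K) x *\<^sub>R f x)"
    using assms(1) by (intro borel_integrable_compact) (auto intro: continuous_on_subset)
  also have "(\<lambda>x. indicator (cball 0 K) x *\<^sub>R f x) = f"
    using assms(2) by (auto simp: indicator_def fun_eq_iff)
  finally show ?thesis .
qed

text \<open>Lebesgue measure is translation invariant, so the difference quotients of F in direction e integrate to zero.\<close>

lemma integral_directional_derivative_eq_0:
  fixes F G :: "'a::euclidean_space \<Rightarrow> real"
  assumes F: "continuous_on UNIV F" and G: "continuous_on UNIV G"
    and D: "\<And>x. ((\<lambda>t. F (x + t *\<^sub>R e)) has_real_derivative G x) (at 0)"
    and supp: "\<And>x. norm x \<ge> K \<Longrightarrow> F x = 0"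
  shows "integral\<^sup>L lborel G = 0"
proof -
  have DL: "((\<lambda>t. F (x + t *\<^sub>R e)) has_real_derivative G (x + t *\<^sub>R e)) (at t)" for x t
    using D[of "x + t *\<^sub>R e"] DERIV_shift[of "\<lambda>t. F (x + t *\<^sub>R e)" "G (x + t *\<^sub>R e)" 0 t]
    by (simp add: algebra_simps)
  define q where "q k x = (F (x + (1 / real (Suc k)) *\<^sub>R e) - F x) * real (Suc k)" for k x
  have intF: "integrable lborel F"
    by (rule continuous_compact_support_integrable[OF F supp])
  have shift: "integral\<^sup>L lborel (\<lambda>x. F (x + c)) = integral\<^sup>L lborel F"
    "integrable lborel (\<lambda>x. F (x + c))" for c
  proof -
    have "integral\<^sup>L lborel F = integral\<^sup>L (distr lborel borel ((+) c)) F"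
      by (simp add: lborel_distr_plus)
    also have "\<dots> = integral\<^sup>L lborel (\<lambda>x. F (c + x))"
      by (rule integral_distr) (use F in \<open>auto intro: borel_measurable_continuous_onI\<close>)
    finally show "integral\<^sup>L lborel (\<lambda>x. F (x + c)) = integral\<^sup>L lborel F" by (simp add: add.commute)
    show "integrable lborel (\<lambda>x. F (x + c))"
    proof (rule continuous_compact_support_integrable[where K = "K + norm c"])
      show "continuous_on UNIV (\<lambda>x. F (x + c))"
        by (intro continuous_on_compose2[OF F] continuous_intros) auto
      fix x :: 'a assume "norm x \<ge> K + norm c"
      then show "F (x + c) = 0"
        by (intro supp) (smt (verit) norm_diff_ineq)
    qed
  qed
  have q0: "integral\<^sup>L lborel (q k) = 0" for k
    unfolding q_def using shift intF by simp
  let ?K = "K + norm e"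
  \<comment> \<open>The ball of radius \<open>?K\<close> contains the supports of all quotients
    \<open>q k\<close>, whose steps are at most 1. The intermediate points of the mean value theorem
    may leave it by another \<open>norm e\<close>.\<close>
  obtain M where M: "\<And>x. x \<in> cball 0 (?K + norm e) \<Longrightarrow> \<bar>G x\<bar> \<le> M"
    using compact_imp_bounded[OF compact_continuous_image[OF continuous_on_subset[OF G] compact_cball]]
    unfolding bounded_iff by (metis image_eqI real_norm_def subset_UNIV)
  have lim: "(\<lambda>k. integral\<^sup>L lborel (q k)) \<longlonglongrightarrow> integral\<^sup>L lborel G"
  proof (rule integral_dominated_convergence[where w = "\<lambda>x. indicator (cball 0 ?K) x *\<^sub>R M"])
    show "G \<in> borel_measurable lborel" using G by (simp add: borel_measurable_continuous_onI)
    show "q k \<in> borel_measurable lborel" for k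
      unfolding q_def using shift intF by (intro borel_measurable_times borel_measurable_diff) auto
    show "integrable lborel (\<lambda>x. indicator (cball 0 ?K) x *\<^sub>R M)"
      by (rule borel_integrable_compact) auto
    have "(\<lambda>k. q k x) \<longlonglongrightarrow> G x" for x
    proof -
      have "((\<lambda>h. (F (x + h *\<^sub>R e) - F x) / h) \<longlongrightarrow> G x) (at 0)"
        using D[of x] unfolding DERIV_def by simp
      moreover have "filterlim (\<lambda>k. 1 / real (Suc k)) (at 0) sequentially"
        unfolding filterlim_at using LIMSEQ_inverse_real_of_nat by (auto simp: inverse_eq_divide)
      ultimately have "(\<lambda>k. (F (x + (1 / real (Suc k)) *\<^sub>R e) - F x) / (1 / real (Suc k))) \<longlonglongrightarrow> G x"
        by (rule filterlim_compose)
      then show ?thesis by (simp add: q_def)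
    qed
    then show "AE x in lborel. (\<lambda>k. q k x) \<longlonglongrightarrow> G x" by simp
    have "norm (q k x) \<le> indicator (cball 0 ?K) x *\<^sub>R M" for k x
    proof -
      define h where "h = 1 / real (Suc k)"
      have h: "0 < h" "h \<le> 1" by (auto simp: h_def)
      show ?thesis
      proof (cases "norm x \<le> ?K")
        case True
        obtain t where t: "0 < t" "t < h" "F (x + h *\<^sub>R e) - F (x + 0 *\<^sub>R e) = (h - 0) * G (x + t *\<^sub>R e)"
          using MVT2[OF h(1) DL] by blast
        have "norm (t *\<^sub>R e) \<le> 1 * norm e" unfolding norm_scaleR using t h by (intro mult_right_mono) auto
        then have "norm (x + t *\<^sub>R e) \<le> ?K + norm e"
          using True norm_triangle_ineq[of x "t *\<^sub>R e"] by simp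
        then have "\<bar>G (x + t *\<^sub>R e)\<bar> \<le> M" using M by simp
        moreover have "q k x = G (x + t *\<^sub>R e)" using t h unfolding q_def h_def[symmetric]
          by (simp add: h_def field_simps)
        ultimately show ?thesis using True by simp
      next
        case False
        have "norm (h *\<^sub>R e) \<le> 1 * norm e" unfolding norm_scaleR using h by (intro mult_right_mono) auto
        then have "norm (x + h *\<^sub>R e) \<ge> K"
          using False norm_diff_ineq[of x "h *\<^sub>R e"] by simp
        moreover have "norm x \<ge> K" using False by (smt (verit) norm_ge_zero)
        ultimately show ?thesis using False supp by (simp add: q_def h_def)
      qed
    qed
    then show "AE x in lborel. norm (q k x) \<le> indicator (cball 0 ?K) x *\<^sub>R M" for k by simp
  qed
  then show ?thesis using q0 LIMSEQ_unique by (simp add: LIMSEQ_const_iff)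
qed

text \<open>The square of a positive part is continuously differentiable. Every cut-off below has
  this form, which is regular enough for one integration by parts.\<close>

lemma has_real_derivative_max0_sq:
  "((\<lambda>t::real. (max 0 t)\<^sup>2) has_real_derivative 2 * max 0 t) (at t)"
proof (cases t "0::real" rule: linorder_cases)
  case less
  have "((\<lambda>t::real. 0) has_real_derivative 2 * max 0 t) (at t)" using less by (simp add: max_def)
  then show ?thesis
    by (rule has_field_derivative_transform_within_open[where S = "{..<0}"]) (use less in auto)
next
  case greater
  have "((\<lambda>t::real. t\<^sup>2) has_real_derivative 2 * max 0 t) (at t)"
    using greater by (auto intro!: derivative_eq_intros)
  then show ?thesis
    by (rule has_field_derivative_transform_within_open[where S = "{0<..}"]) (use greater in auto)
next
  case equal
  have "((\<lambda>h::real. (max 0 h)\<^sup>2 / h) \<longlongrightarrow> 0) (at 0)"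
  proof (rule Lim_null_comparison)
    show "eventually (\<lambda>h::real. norm ((max 0 h)\<^sup>2 / h) \<le> \<bar>h\<bar>) (at 0)"
      by (intro always_eventually allI) (auto simp: max_def power2_eq_square)
    show "((\<lambda>h::real. \<bar>h\<bar>) \<longlongrightarrow> 0) (at 0)"
      using tendsto_rabs[OF tendsto_ident_at[of "0::real" UNIV]] by simp
  qed
  then show ?thesis unfolding DERIV_def equal by simp
qed

lemma integral_divergence_eq_0:
  fixes F G :: "'n::finite \<Rightarrow> real ^ 'n \<Rightarrow> real"
  assumes "\<And>i. continuous_on UNIV (F i)" "\<And>i. continuous_on UNIV (G i)"
    and "\<And>i x. ((\<lambda>t. F i (x + t *\<^sub>R axis i 1)) has_real_derivative G i x) (at 0)"
    and "\<And>i x. norm x \<ge> K \<Longrightarrow> F i x = 0" "\<And>i x. norm x \<ge> K \<Longrightarrow> G i x = 0"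
  shows "integral\<^sup>L lborel (\<lambda>x. \<Sum>i\<in>UNIV. G i x) = 0"
proof -
  have "integrable lborel (G i)" for i
    by (rule continuous_compact_support_integrable[of _ K]) (use assms in auto)
  moreover have "integral\<^sup>L lborel (G i) = 0" for i
    by (rule integral_directional_derivative_eq_0[of "F i" "G i" "axis i 1" K]) (use assms in auto)
  ultimately show ?thesis by (subst Bochner_Integration.integral_sum) auto
qed

lemma blinfun_axis_expand: "blinfun_apply f x = (\<Sum>j\<in>UNIV. (x $ j) * blinfun_apply f (axis j 1))"
  for f :: "(real ^ 'n::finite) \<Rightarrow>\<^sub>L real"
proof -
  have "blinfun_apply f x = blinfun_apply f (\<Sum>j\<in>UNIV. (x $ j) *\<^sub>R axis j 1)"
    using basis_expansion[of x] by (simp add: scalar_mult_eq_scaleR)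
  then show ?thesis by (simp add: blinfun.sum_right blinfun.scaleR_right)
qed

lemma norm_sq_line_DERIV:
  "((\<lambda>t. (norm (x + t *\<^sub>R axis i 1 :: real ^ 'n::finite))\<^sup>2) has_real_derivative 2 * (x $ i)) (at 0)"
  unfolding norm_line_sq by (auto intro!: derivative_eq_intros)

lemma radial_DERIV:
  assumes "\<And>s. s \<ge> 0 \<Longrightarrow> (\<phi> has_real_derivative \<phi>' s) (at s)"
  shows "((\<lambda>t. \<phi> ((norm (x + t *\<^sub>R axis i 1 :: real ^ 'n::finite))\<^sup>2)) has_real_derivative
    \<phi>' ((norm x)\<^sup>2) * (2 * (x $ i))) (at 0)"
  using DERIV_chain2[OF _ norm_sq_line_DERIV[of x i], of \<phi> "\<phi>' ((norm x)\<^sup>2)"] assms[of "(norm x)\<^sup>2"] by simp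

section \<open>The squared gradient and the decay of b - u\<close>

context C2_fun
begin

abbreviation grad_sq :: "real ^ 'n \<Rightarrow> real" where
  "grad_sq x \<equiv> (\<Sum>i\<in>UNIV. (D1 x (axis i 1))\<^sup>2)"

lemma grad_sq_nonneg: "grad_sq x \<ge> 0" by (simp add: sum_nonneg)

lemma cont_grad_sq: "continuous_on A grad_sq"
  by (intro continuous_intros)

lemma radial_derivative_sq_le: "(D1 x x)\<^sup>2 \<le> (norm x)\<^sup>2 * grad_sq x"
  using Cauchy_Schwarz_ineq_sum[of "\<lambda>j. x $ j" "\<lambda>j. D1 x (axis j 1)" UNIV]
  unfolding blinfun_axis_expand[of "D1 x" x] sum_axis_sq .

text \<open>The barrier b - C |x|^(2-n) is harmonic, and C is normalised so that it equals
  \<open>m\<close> at |x| = R. Where \<open>u\<close> is below it, \<open>u\<close> is below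
  \<open>b\<close>, so the Laplacian of \<open>u\<close> is negative; \<open>lim\<close> controls
  infinity.\<close>

lemma exterior_decay:
  fixes g :: "real \<Rightarrow> real"
  defines "\<alpha> \<equiv> (real CARD('n) - 2) / 2"
  assumes n: "CARD('n) \<ge> 3" and R: "R > 0"
    and g: "\<And>s. m \<le> s \<Longrightarrow> s < b \<Longrightarrow> g s < 0"
    and lap: "\<And>x. norm x \<ge> R \<Longrightarrow> laplacian u x = g (u x)"
    and bnd: "\<And>x. norm x \<ge> R \<Longrightarrow> m \<le> u x \<and> u x \<le> b"
    and lim: "\<And>\<epsilon>. \<epsilon> > 0 \<Longrightarrow> \<exists>K. \<forall>x. norm x \<ge> K \<longrightarrow> b - \<epsilon> < u x"
    and x: "norm x \<ge> R" and mb: "m \<le> b"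
  shows "b - (b - m) * (R\<^sup>2) powr \<alpha> * ((norm x)\<^sup>2) powr (-\<alpha>) \<le> u x"
proof (rule exterior_comparison[OF R x,
      where f = "\<lambda>s. b - (b - m) * (R\<^sup>2) powr \<alpha> * s powr (-\<alpha>)"
        and f' = "\<lambda>s. \<alpha> * ((b - m) * (R\<^sup>2) powr \<alpha>) * s powr (-\<alpha> - 1)"
        and f'' = "\<lambda>s. - \<alpha> * (\<alpha> + 1) * ((b - m) * (R\<^sup>2) powr \<alpha>) * s powr (-\<alpha> - 2)"])
  have n\<alpha>: "real CARD('n) = 2 * \<alpha> + 2" by (simp add: \<alpha>_def field_simps)
  have r2: "R\<^sup>2 > 0" using R by simp
  define C where "C = (b - m) * (R\<^sup>2) powr \<alpha>"
  have C: "C \<ge> 0" using mb by (simp add: C_def)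
  have pos: "s > 0" if "s > R\<^sup>2" for s using that by (meson le_less_trans zero_le_power2)
  have D: "((\<lambda>s. s powr c) has_real_derivative c * s powr d) (at s)" if "s > R\<^sup>2" "d = c - 1" for c d s
    using has_real_derivative_powr[OF pos[OF that(1)], of c] that(2) by simp
  show "((\<lambda>s. b - (b - m) * (R\<^sup>2) powr \<alpha> * s powr (-\<alpha>)) has_real_derivative
      \<alpha> * ((b - m) * (R\<^sup>2) powr \<alpha>) * s powr (-\<alpha> - 1)) (at s)" if "s > R\<^sup>2" for s
    unfolding C_def[symmetric]
    by (rule DERIV_cong[OF DERIV_diff[OF DERIV_const DERIV_cmult[OF D[OF that, of "-\<alpha> - 1"]]]]) auto
  show "((\<lambda>s. \<alpha> * ((b - m) * (R\<^sup>2) powr \<alpha>) * s powr (-\<alpha> - 1)) has_real_derivative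
      - \<alpha> * (\<alpha> + 1) * ((b - m) * (R\<^sup>2) powr \<alpha>) * s powr (-\<alpha> - 2)) (at s)" if "s > R\<^sup>2" for s
    unfolding C_def[symmetric]
    by (rule DERIV_cong[OF DERIV_cmult[OF D[OF that, of "-\<alpha> - 2"]]]) (auto simp: algebra_simps)
  show "continuous_on {R\<^sup>2..} (\<lambda>s. b - (b - m) * (R\<^sup>2) powr \<alpha> * s powr (-\<alpha>))"
  proof (intro continuous_intros)
    show "\<forall>s\<in>{R\<^sup>2..}. s \<noteq> 0" using r2 by auto
  qed
  show "b - (b - m) * (R\<^sup>2) powr \<alpha> * (R\<^sup>2) powr (-\<alpha>) \<le> u x" if "norm x = R" for x
    using bnd[of x] that r2 by (simp add: powr_minus field_simps)
  show "\<exists>K. \<forall>x. norm x \<ge> K \<longrightarrow> b - (b - m) * (R\<^sup>2) powr \<alpha> * ((norm x)\<^sup>2) powr (-\<alpha>) - \<epsilon> \<le> u x"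
    if "\<epsilon> > 0" for \<epsilon>
    using lim[OF that] C unfolding C_def[symmetric]
    by (smt (verit, best) mult_nonneg_nonneg powr_ge_zero)
  fix x :: "real^'n"
  assume x: "norm x > R" and lt: "u x < b - (b - m) * (R\<^sup>2) powr \<alpha> * ((norm x)\<^sup>2) powr (-\<alpha>)"
  have s: "(norm x)\<^sup>2 > 0" using x R by auto
  have "C * ((norm x)\<^sup>2) powr (-\<alpha>) \<ge> 0" using C by simp
  then have "laplacian u x < 0" using lt g[of "u x"] bnd[of x] lap[of x] x by (simp add: C_def)
  also have "0 = 4 * (norm x)\<^sup>2 * (- \<alpha> * (\<alpha> + 1) * C * ((norm x)\<^sup>2) powr (-\<alpha> - 2))
     + 2 * real CARD('n) * (\<alpha> * C * ((norm x)\<^sup>2) powr (-\<alpha> - 1))"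
    unfolding n\<alpha> powr_step[OF s, of "-\<alpha> - 2" "-\<alpha> - 1", simplified] by (simp add: algebra_simps)
  finally show "laplacian u x < 4 * (norm x)\<^sup>2 * (- \<alpha> * (\<alpha> + 1) * ((b - m) * (R\<^sup>2) powr \<alpha>) * ((norm x)\<^sup>2) powr (-\<alpha> - 2))
     + 2 * real CARD('n) * (\<alpha> * ((b - m) * (R\<^sup>2) powr \<alpha>) * ((norm x)\<^sup>2) powr (-\<alpha> - 1))"
    by (simp only: C_def)
qed

text \<open>Only one factor of the square has to decay, the other is bounded by
  \<open>b - m\<close>. In the plane the weight is the zeroth power, so boundedness is enough. The
  estimate is what makes K^(-2) times the integral of (u - b)^2 over a ball of radius K
  bounded.\<close>

lemma decay_bound:
  fixes g :: "real \<Rightarrow> real"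
  assumes n: "CARD('n) \<ge> 2" and R: "R > 0"
    and g: "\<And>s. m \<le> s \<Longrightarrow> s < b \<Longrightarrow> g s < 0"
    and lap: "\<And>x. norm x \<ge> R \<Longrightarrow> laplacian u x = g (u x)"
    and bnd: "\<And>x. norm x \<ge> R \<Longrightarrow> m \<le> u x \<and> u x \<le> b"
    and lim: "\<And>\<epsilon>. \<epsilon> > 0 \<Longrightarrow> \<exists>K. \<forall>x. norm x \<ge> K \<longrightarrow> b - \<epsilon> < u x"
  obtains C where "\<And>x. norm x ^ (CARD('n) - 2) * (u x - b)\<^sup>2 \<le> C"
proof -
  obtain y :: "real^'n" where "norm y = R" using vector_choose_size[of R] R less_imp_le by blast
  then have mb: "m \<le> b" using bnd[of y] by simp
  have "\<exists>C1. \<forall>x. norm x \<ge> R \<longrightarrow> norm x ^ (CARD('n) - 2) * (b - u x) \<le> C1"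
  proof (cases "CARD('n) = 2")
    case True
    then show ?thesis using bnd by (intro exI[of _ "b - m"]) auto
  next
    case False
    then have n3: "CARD('n) \<ge> 3" using n by simp
    define \<alpha> where "\<alpha> = (real CARD('n) - 2) / 2"
    define C where "C = (b - m) * (R\<^sup>2) powr \<alpha>"
    have "norm x ^ (CARD('n) - 2) * (b - u x) \<le> C" if x: "norm x \<ge> R" for x
    proof -
      have pos: "norm x > 0" using x R by linarith
      have \<alpha>2: "2 * \<alpha> = real (CARD('n) - 2)" using n by (simp add: \<alpha>_def of_nat_diff field_simps)
      have "((norm x)\<^sup>2) powr \<alpha> = (norm x powr 2) powr \<alpha>" using pos by simp
      also have "\<dots> = norm x powr real (CARD('n) - 2)"
        unfolding powr_powr \<alpha>2 ..
      also have "\<dots> = norm x ^ (CARD('n) - 2)" using pos by (rule powr_realpow)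
      finally have *: "((norm x)\<^sup>2) powr \<alpha> = norm x ^ (CARD('n) - 2)" .
      have "b - u x \<le> C * ((norm x)\<^sup>2) powr (-\<alpha>)"
        using exterior_decay[where g = g and m = m and b = b and R = R and x = x] n3 R g lap bnd lim x mb
        by (simp add: C_def \<alpha>_def)
      then have "((norm x)\<^sup>2) powr \<alpha> * (b - u x) \<le> ((norm x)\<^sup>2) powr \<alpha> * (C * ((norm x)\<^sup>2) powr (-\<alpha>))"
        by (intro mult_left_mono) auto
      also have "\<dots> = C" using pos by (simp add: powr_minus field_simps)
      finally show ?thesis unfolding * .
    qed
    then show ?thesis by blast
  qed
  then obtain C1 where C1: "\<And>x. norm x \<ge> R \<Longrightarrow> norm x ^ (CARD('n) - 2) * (b - u x) \<le> C1" by blast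
  have cont: "continuous_on (cball 0 R) (\<lambda>x. norm x ^ (CARD('n) - 2) * (u x - b)\<^sup>2)"
    by (intro continuous_intros cont_u)
  have "cball (0::real^'n) R \<noteq> {}" using R by simp
  from continuous_attains_sup[OF compact_cball this cont]
  obtain C2 where C2: "\<And>x. norm x \<le> R \<Longrightarrow> norm x ^ (CARD('n) - 2) * (u x - b)\<^sup>2 \<le> C2"
    unfolding Ball_def mem_cball_0 by blast
  have "norm x ^ (CARD('n) - 2) * (u x - b)\<^sup>2 \<le> max C2 (C1 * (b - m))" for x
  proof (cases "norm x \<le> R")
    case True
    then show ?thesis using C2 by (simp add: le_max_iff_disj)
  next
    case False
    have "norm x ^ (CARD('n) - 2) * (u x - b)\<^sup>2 = norm x ^ (CARD('n) - 2) * (b - u x) * (b - u x)"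
      by (simp add: power2_eq_square algebra_simps)
    also have "\<dots> \<le> C1 * (b - m)"
    proof (rule mult_mono)
      show "norm x ^ (CARD('n) - 2) * (b - u x) \<le> C1" using C1 False by simp
      show "0 \<le> C1" using C1[of x] bnd[of x] False
        by (smt (verit) mult_nonneg_nonneg norm_ge_zero zero_le_power)
    qed (use bnd[of x] False in auto)
    finally show ?thesis by simp
  qed
  then show thesis by (rule that)
qed

end

section \<open>The Caccioppoli and Pohozaev identities\<close>

context C2_fun
begin

lemma cont_radial:
  assumes "continuous_on {0..} \<phi>"
  shows "continuous_on A (\<lambda>x::real ^ 'n. \<phi> ((norm x)\<^sup>2))"
  by (intro continuous_on_compose2[OF assms] continuous_intros) auto

text \<open>The integrand is the divergence of \<phi>(|x|^2) (u - b) grad u, that is, the equation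
  tested with (u - b) times a radial cut-off.\<close>

lemma caccioppoli_identity:
  assumes \<phi>: "\<And>s. s \<ge> 0 \<Longrightarrow> (\<phi> has_real_derivative \<phi>' s) (at s)"
    and \<phi>': "continuous_on {0..} \<phi>'"
    and supp: "\<And>s. s \<ge> K\<^sup>2 \<Longrightarrow> \<phi> s = 0" "\<And>s. s \<ge> K\<^sup>2 \<Longrightarrow> \<phi>' s = 0" and K: "K \<ge> 0"
    and g: "\<And>x. laplacian u x = g (u x)"
  shows "(LINT x|lborel. \<phi> ((norm x)\<^sup>2) * grad_sq x + \<phi> ((norm x)\<^sup>2) * (u x - b) * g (u x)
    + 2 * \<phi>' ((norm x)\<^sup>2) * (u x - b) * D1 x x) = 0"
proof -
  have cont\<phi>: "continuous_on {0..} \<phi>"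
    by (intro continuous_at_imp_continuous_on ballI DERIV_isCont[OF \<phi>]) simp
  define F where "F i x = \<phi> ((norm x)\<^sup>2) * (u x - b) * D1 x (axis i 1)" for i :: 'n and x :: "real^'n"
  define G where "G i x = \<phi>' ((norm x)\<^sup>2) * (2 * (x $ i)) * (u x - b) * D1 x (axis i 1)
    + \<phi> ((norm x)\<^sup>2) * (D1 x (axis i 1))\<^sup>2
    + \<phi> ((norm x)\<^sup>2) * (u x - b) * D2 x (axis i 1) (axis i 1)" for i :: 'n and x :: "real^'n"
  have "integral\<^sup>L lborel (\<lambda>x. \<Sum>i\<in>UNIV. G i x) = 0"
  proof (rule integral_divergence_eq_0[of F G K])
    show "continuous_on UNIV (F i)" "continuous_on UNIV (G i)" for i
      unfolding F_def G_def
      by (intro continuous_intros cont_u cont_radial[OF \<phi>'] cont_radial[OF cont\<phi>])+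
    have "(norm x)\<^sup>2 \<ge> K\<^sup>2" if "norm x \<ge> K" for x :: "real^'n"
      using that K by (rule power_mono)
    then show "F i x = 0" "G i x = 0" if "norm x \<ge> K" for i x
      using that supp by (auto simp: F_def G_def)
    fix i :: 'n and x :: "real^'n"
    have 1: "((\<lambda>t. \<phi> ((norm (x + t *\<^sub>R axis i 1))\<^sup>2)) has_real_derivative \<phi>' ((norm x)\<^sup>2) * (2 * (x $ i))) (at 0)"
      by (rule radial_DERIV[OF \<phi>])
    have 2: "((\<lambda>t. u (x + t *\<^sub>R axis i 1)) has_real_derivative D1 x (axis i 1)) (at 0)"
      using DERIV_line[of x "axis i 1" 0] by simp
    have 3: "((\<lambda>t. D1 (x + t *\<^sub>R axis i 1) (axis i 1)) has_real_derivative D2 x (axis i 1) (axis i 1)) (at 0)"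
      using DERIV_D1_line[of x "axis i 1" "axis i 1" 0] by simp
    show "((\<lambda>t. F i (x + t *\<^sub>R axis i 1)) has_real_derivative G i x) (at 0)"
      unfolding F_def G_def
      by (rule DERIV_cong[OF DERIV_mult[OF DERIV_mult[OF 1 DERIV_diff[OF 2 DERIV_const]] 3]])
        (simp add: power2_eq_square algebra_simps)
  qed
  also have "(\<lambda>x. \<Sum>i\<in>UNIV. G i x) = (\<lambda>x. \<phi> ((norm x)\<^sup>2) * grad_sq x + \<phi> ((norm x)\<^sup>2) * (u x - b) * g (u x)
    + 2 * \<phi>' ((norm x)\<^sup>2) * (u x - b) * D1 x x)"
  proof
    fix x
    have "(\<Sum>i\<in>UNIV. \<phi>' ((norm x)\<^sup>2) * (2 * (x $ i)) * (u x - b) * D1 x (axis i 1))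
        = 2 * \<phi>' ((norm x)\<^sup>2) * (u x - b) * D1 x x"
      unfolding blinfun_axis_expand[of "D1 x" x] sum_distrib_left by (intro sum.cong) auto
    then show "(\<Sum>i\<in>UNIV. G i x) = \<phi> ((norm x)\<^sup>2) * grad_sq x + \<phi> ((norm x)\<^sup>2) * (u x - b) * g (u x)
      + 2 * \<phi>' ((norm x)\<^sup>2) * (u x - b) * D1 x x"
      unfolding G_def sum.distrib g[symmetric] laplacian_u by (simp add: sum_distrib_left)
  qed
  finally show ?thesis .
qed

text \<open>The divergence of the stress-energy tensor contracted with \<open>\<phi>(\<bar>x\<bar>\<^sup>2) x\<close>.\<close>

lemma pohozaev_identity:
  assumes \<phi>: "\<And>s. s \<ge> 0 \<Longrightarrow> (\<phi> has_real_derivative \<phi>' s) (at s)"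
    and \<phi>': "continuous_on {0..} \<phi>'"
    and supp: "\<And>s. s \<ge> K\<^sup>2 \<Longrightarrow> \<phi> s = 0" "\<And>s. s \<ge> K\<^sup>2 \<Longrightarrow> \<phi>' s = 0" and K: "K \<ge> 0"
    and g: "\<And>x. laplacian u x = g (u x)"
    and W: "\<And>s. (W has_real_derivative g s) (at s)" and g_cont: "continuous_on UNIV g"
  shows "(LINT x|lborel. 2 * \<phi>' ((norm x)\<^sup>2) * ((D1 x x)\<^sup>2 - (norm x)\<^sup>2 * (grad_sq x / 2 + W (u x)))
    + \<phi> ((norm x)\<^sup>2) * (grad_sq x - real CARD('n) * (grad_sq x / 2 + W (u x)))) = 0"
proof -
  have cont\<phi>: "continuous_on {0..} \<phi>"
    by (intro continuous_at_imp_continuous_on ballI DERIV_isCont[OF \<phi>]) simp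
  have contW: "continuous_on UNIV W"
    by (intro continuous_at_imp_continuous_on ballI DERIV_isCont[OF W])
  define e where "e x = grad_sq x / 2 + W (u x)" for x
  \<comment> \<open>\<open>de i\<close> is the i-th partial derivative of the energy density
    \<open>e\<close>, and \<open>G i\<close> is that of \<open>F i\<close>.\<close>
  define de where "de i x = (\<Sum>j\<in>UNIV. D1 x (axis j 1) * D2 x (axis i 1) (axis j 1)) + g (u x) * D1 x (axis i 1)"
    for i x
  define F where "F i x = \<phi> ((norm x)\<^sup>2) * (D1 x (axis i 1) * D1 x x - (x $ i) * e x)" for i :: 'n and x :: "real^'n"
  define G where "G i x = \<phi>' ((norm x)\<^sup>2) * (2 * (x $ i)) * (D1 x (axis i 1) * D1 x x - (x $ i) * e x)
    + \<phi> ((norm x)\<^sup>2) * (D2 x (axis i 1) (axis i 1) * D1 x x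
        + D1 x (axis i 1) * (D2 x (axis i 1) x + D1 x (axis i 1)) - e x - (x $ i) * de i x)"
    for i :: 'n and x :: "real^'n"
  have "integral\<^sup>L lborel (\<lambda>x. \<Sum>i\<in>UNIV. G i x) = 0"
  proof (rule integral_divergence_eq_0[of F G K])
    have conte: "continuous_on UNIV e"
      unfolding e_def by (intro continuous_intros continuous_on_compose2[OF contW] cont_u) auto
    have contde: "continuous_on UNIV (de i)" for i
      unfolding de_def by (intro continuous_intros continuous_on_compose2[OF g_cont] cont_u) auto
    show "continuous_on UNIV (F i)" "continuous_on UNIV (G i)" for i
      unfolding F_def G_def
      by (intro continuous_intros cont_u cont_radial[OF \<phi>'] cont_radial[OF cont\<phi>] conte contde)+
    have "(norm x)\<^sup>2 \<ge> K\<^sup>2" if "norm x \<ge> K" for x :: "real^'n"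
      using that K by (rule power_mono)
    then show "F i x = 0" "G i x = 0" if "norm x \<ge> K" for i x
      using that supp by (auto simp: F_def G_def)
    fix i :: 'n and x :: "real^'n"
    have 1: "((\<lambda>t. \<phi> ((norm (x + t *\<^sub>R axis i 1))\<^sup>2)) has_real_derivative \<phi>' ((norm x)\<^sup>2) * (2 * (x $ i))) (at 0)"
      by (rule radial_DERIV[OF \<phi>])
    have 2: "((\<lambda>t. u (x + t *\<^sub>R axis i 1)) has_real_derivative D1 x (axis i 1)) (at 0)"
      using DERIV_line[of x "axis i 1" 0] by simp
    have 3: "((\<lambda>t. D1 (x + t *\<^sub>R axis i 1) y) has_real_derivative D2 x (axis i 1) y) (at 0)" for y
      using DERIV_D1_line[of x "axis i 1" y 0] by simp
    have 4: "((\<lambda>t. D1 (x + t *\<^sub>R axis i 1) (x + t *\<^sub>R axis i 1)) has_real_derivative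
        D2 x (axis i 1) x + D1 x (axis i 1)) (at 0)"
      unfolding blinfun.add_right blinfun.scaleR_right real_scaleR_def
      by (rule DERIV_cong[OF DERIV_add[OF 3 DERIV_mult[OF DERIV_ident 3]]]) simp
    have 5: "((\<lambda>t. (x + t *\<^sub>R axis i 1) $ i) has_real_derivative 1) (at 0)"
      by (auto intro!: derivative_eq_intros)
    have 6: "((\<lambda>t. W (u (x + t *\<^sub>R axis i 1))) has_real_derivative g (u x) * D1 x (axis i 1)) (at 0)"
      by (rule DERIV_chain2[OF _ 2]) (simp add: W)
    have 7: "((\<lambda>t. e (x + t *\<^sub>R axis i 1)) has_real_derivative de i x) (at 0)"
      unfolding e_def de_def
      by (rule DERIV_cong[OF DERIV_add[OF DERIV_cdivide[OF DERIV_sum[OF DERIV_power[OF 3]]] 6]])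
        (simp add: sum_distrib_left sum_divide_distrib mult.commute)
    show "((\<lambda>t. F i (x + t *\<^sub>R axis i 1)) has_real_derivative G i x) (at 0)"
      unfolding F_def G_def
      by (rule DERIV_cong[OF DERIV_mult[OF 1 DERIV_diff[OF DERIV_mult[OF 3 4] DERIV_mult[OF 5 7]]]])
        (simp add: algebra_simps)
  qed
  also have "(\<lambda>x. \<Sum>i\<in>UNIV. G i x) = (\<lambda>x. 2 * \<phi>' ((norm x)\<^sup>2) * ((D1 x x)\<^sup>2 - (norm x)\<^sup>2 * (grad_sq x / 2 + W (u x)))
    + \<phi> ((norm x)\<^sup>2) * (grad_sq x - real CARD('n) * (grad_sq x / 2 + W (u x))))"
  proof
    fix x
    have S1: "(\<Sum>i\<in>UNIV. (x $ i) * D1 x (axis i 1)) = D1 x x"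
      by (rule blinfun_axis_expand[symmetric])
    have "(\<Sum>i\<in>UNIV. (x $ i) * (D1 x (axis i 1) * D1 x x - (x $ i) * e x)) = (D1 x x)\<^sup>2 - (norm x)\<^sup>2 * e x"
    proof -
      have "(\<Sum>i\<in>UNIV. (x $ i) * (D1 x (axis i 1) * D1 x x - (x $ i) * e x))
        = (\<Sum>i\<in>UNIV. (x $ i) * D1 x (axis i 1)) * D1 x x - (\<Sum>i\<in>UNIV. (x $ i)\<^sup>2) * e x"
        unfolding sum_distrib_right sum_subtractf[symmetric]
        by (intro sum.cong) (auto simp: power2_eq_square algebra_simps)
      then show ?thesis unfolding S1 sum_axis_sq by (simp add: power2_eq_square)
    qed
    then have A: "(\<Sum>i\<in>UNIV. \<phi>' ((norm x)\<^sup>2) * (2 * (x $ i)) * (D1 x (axis i 1) * D1 x x - (x $ i) * e x))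
        = 2 * \<phi>' ((norm x)\<^sup>2) * ((D1 x x)\<^sup>2 - (norm x)\<^sup>2 * e x)"
      by (simp add: sum_distrib_left[symmetric] mult.assoc mult.left_commute[of _ 2])
    \<comment> \<open>By symmetry of \<open>D2\<close>, the Hessian terms from differentiating
      \<open>D1 x x\<close> equal those from the gradient of half of \<open>grad_sq\<close>, so they
      cancel.\<close>
    have B1: "(\<Sum>i\<in>UNIV. D1 x (axis i 1) * D2 x (axis i 1) x)
        = (\<Sum>i\<in>UNIV. (x $ i) * (\<Sum>j\<in>UNIV. D1 x (axis j 1) * D2 x (axis i 1) (axis j 1)))"
    proof -
      have "(\<Sum>i\<in>UNIV. D1 x (axis i 1) * D2 x (axis i 1) x)
        = (\<Sum>i\<in>UNIV. \<Sum>j\<in>UNIV. (x $ j) * (D1 x (axis i 1) * D2 x (axis j 1) (axis i 1)))"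
        unfolding blinfun_axis_expand[of "D2 x _" x] sum_distrib_left
        by (intro sum.cong refl) (simp add: D2_sym[of x "axis _ 1" "axis _ 1"] mult.left_commute)
      also have "\<dots> = (\<Sum>j\<in>UNIV. \<Sum>i\<in>UNIV. (x $ j) * (D1 x (axis i 1) * D2 x (axis j 1) (axis i 1)))"
        by (rule sum.swap)
      finally show ?thesis by (simp add: sum_distrib_left)
    qed
    have B2: "(\<Sum>i\<in>UNIV. (x $ i) * de i x) = (\<Sum>i\<in>UNIV. D1 x (axis i 1) * D2 x (axis i 1) x) + g (u x) * D1 x x"
    proof -
      have "(\<Sum>i\<in>UNIV. (x $ i) * (g (u x) * D1 x (axis i 1))) = g (u x) * D1 x x"
        unfolding S1[symmetric] sum_distrib_left by (simp add: mult.left_commute)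
      then show ?thesis unfolding B1 de_def by (simp add: distrib_left sum.distrib)
    qed
    \<comment> \<open>The equation replaces the Laplacian by \<open>g (u x)\<close>; this cancels
      the derivative of the potential in \<open>B2\<close>.\<close>
    have B3: "(\<Sum>i\<in>UNIV. D2 x (axis i 1) (axis i 1) * D1 x x) = g (u x) * D1 x x"
      unfolding g[symmetric] laplacian_u by (simp add: sum_distrib_right)
    have "(\<Sum>i\<in>UNIV. D2 x (axis i 1) (axis i 1) * D1 x x
        + D1 x (axis i 1) * (D2 x (axis i 1) x + D1 x (axis i 1)) - e x - (x $ i) * de i x)
      = grad_sq x - real CARD('n) * e x"
      using B2 B3 by (simp add: sum.distrib sum_subtractf distrib_left power2_eq_square)
    then have B: "(\<Sum>i\<in>UNIV. \<phi> ((norm x)\<^sup>2) * (D2 x (axis i 1) (axis i 1) * D1 x x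
        + D1 x (axis i 1) * (D2 x (axis i 1) x + D1 x (axis i 1)) - e x - (x $ i) * de i x))
      = \<phi> ((norm x)\<^sup>2) * (grad_sq x - real CARD('n) * e x)"
      by (simp add: sum_distrib_left[symmetric])
    show "(\<Sum>i\<in>UNIV. G i x) = 2 * \<phi>' ((norm x)\<^sup>2) * ((D1 x x)\<^sup>2 - (norm x)\<^sup>2 * (grad_sq x / 2 + W (u x)))
      + \<phi> ((norm x)\<^sup>2) * (grad_sq x - real CARD('n) * (grad_sq x / 2 + W (u x)))"
      unfolding G_def sum.distrib A B by (simp only: e_def)
  qed
  finally show ?thesis .
qed

end

section \<open>Finite Dirichlet energy\<close>

lemma integrable_indicator_cball:
  fixes h :: "'a::euclidean_space \<Rightarrow> real"
  assumes "continuous_on UNIV h"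
  shows "integrable lborel (\<lambda>x. indicator (cball c K) x * h x)"
  using borel_integrable_compact[OF compact_cball continuous_on_subset[OF assms subset_UNIV], of c K] by simp

lemma measure_cball_0:
  "0 \<le> K \<Longrightarrow> measure lborel (cball (0::real ^ 'n::finite) K) = unit_ball_vol (real CARD('n)) * K ^ CARD('n)"
  by (simp add: content_cball)

context C2_fun
begin

text \<open>With a cut-off at scale K, the cross term is absorbed by half of the weighted energy up
  to a remainder of size K^(-n) on the ball of radius K. Its integral is a constant independent of
  K.\<close>

lemma local_energy_bound:
  assumes lap: "\<And>x. laplacian u x = g (u x)" and g_cont: "continuous_on UNIV g"
    and sign: "\<And>x. norm x \<ge> R \<Longrightarrow> (u x - b) * g (u x) \<ge> 0"
    and n: "CARD('n) \<ge> 2"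
    and C: "\<And>x. norm x ^ (CARD('n) - 2) * (u x - b)\<^sup>2 \<le> C"
  obtains B where "\<And>K. K > 0 \<Longrightarrow> (LINT x|lborel. indicator (cball 0 K) x * grad_sq x) \<le> B"
proof -
  let ?n = "CARD('n)"
  have cont_gu: "continuous_on UNIV (\<lambda>x. (u x - b) * g (u x))"
    by (intro continuous_intros cont_u continuous_on_compose2[OF g_cont]) auto
  have "bounded ((\<lambda>x. (u x - b) * g (u x)) ` cball 0 R)"
    by (intro compact_imp_bounded compact_continuous_image continuous_on_subset[OF cont_gu]) auto
  then obtain M where M: "\<And>x. x \<in> cball 0 R \<Longrightarrow> \<bar>(u x - b) * g (u x)\<bar> \<le> M"
    unfolding bounded_iff ball_simps real_norm_def by blast
  define M' where "M' = max 0 M"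
  \<comment> \<open>The sign is known only outside radius \<open>R\<close>; \<open>M'\<close> pays
    for the compact rest.\<close>
  have M': "(u x - b) * g (u x) \<ge> - M' * indicator (cball 0 R) x" for x
    using M[of x] sign[of x] by (cases "norm x \<le> R") (auto simp: M'_def indicator_def)
  have M'0: "M' \<ge> 0" by (simp add: M'_def)
  define \<omega> where "\<omega> = unit_ball_vol (real ?n)"
  define B where "B = 2 * (M' * measure lborel (cball (0::real^'n) R) + 8 * (real ?n)\<^sup>2 * C * \<omega>)"
  have cut: "(LINT x|lborel. indicator (cball 0 (K / 2)) x * grad_sq x) \<le> 2 * B" if K: "K > 0" for K
  proof -
    \<comment> \<open>The power n makes the derivative of the cut-off vanish at the origin fast
      enough to absorb the factor |x|^(2-n) of the decay bound, so the cross term is estimated on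
      the whole ball and not just on an annulus.\<close>
    define \<zeta> where "\<zeta> s = max 0 (1 - (s / K\<^sup>2) ^ ?n)" for s
    define \<psi> where "\<psi> s = real ?n * (s / K\<^sup>2) ^ (?n - 1) / K\<^sup>2" for s
    define \<phi> where "\<phi> s = (\<zeta> s)\<^sup>2" for s
    define \<phi>' where "\<phi>' s = - 2 * \<zeta> s * \<psi> s" for s
    have K2: "K\<^sup>2 > 0" using K by simp
    have \<zeta>0: "\<zeta> s = 0" if "s \<ge> K\<^sup>2" for s
      using that K2 by (simp add: \<zeta>_def)
    have \<zeta>01: "0 \<le> \<zeta> s" "\<zeta> s \<le> 1" if "s \<ge> 0" for s using that by (auto simp: \<zeta>_def)
    define H where "H x = \<phi> ((norm x)\<^sup>2) * grad_sq x + \<phi> ((norm x)\<^sup>2) * (u x - b) * g (u x)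
      + 2 * \<phi>' ((norm x)\<^sup>2) * (u x - b) * D1 x x" for x
    have DER: "(\<phi> has_real_derivative \<phi>' s) (at s)" for s
    proof -
      have "((\<lambda>s. 1 - (s / K\<^sup>2) ^ ?n) has_real_derivative - \<psi> s) (at s)"
        unfolding \<psi>_def
        by (rule DERIV_cong[OF DERIV_diff[OF DERIV_const DERIV_power[OF DERIV_cdivide[OF DERIV_ident]]]]) simp
      from DERIV_chain2[OF has_real_derivative_max0_sq this] show ?thesis
        unfolding \<phi>_def \<phi>'_def \<zeta>_def by simp
    qed
    have cont\<zeta>: "continuous_on A \<zeta>" "continuous_on A \<psi>" for A
      unfolding \<zeta>_def \<psi>_def using K by (auto intro!: continuous_intros)
    have int0: "integral\<^sup>L lborel H = 0"
      unfolding H_def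
    proof (rule caccioppoli_identity[where K = K])
      show "continuous_on {0..} \<phi>'" unfolding \<phi>'_def by (intro continuous_intros cont\<zeta>)
      show "\<phi> s = 0" "\<phi>' s = 0" if "s \<ge> K\<^sup>2" for s using \<zeta>0[OF that] by (simp_all add: \<phi>_def \<phi>'_def)
    qed (use DER K lap in auto)
    have contH: "continuous_on UNIV H"
    proof -
      have "continuous_on UNIV (\<lambda>x::real^'n. \<phi> ((norm x)\<^sup>2))" "continuous_on UNIV (\<lambda>x::real^'n. \<phi>' ((norm x)\<^sup>2))"
        by (rule cont_radial, simp add: \<phi>_def \<phi>'_def, intro continuous_intros cont\<zeta>)+
      then show ?thesis unfolding H_def
        by (intro continuous_intros cont_u continuous_on_compose2[OF g_cont]) auto
    qed
    have intH: "integrable lborel H"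
    proof (rule continuous_compact_support_integrable[OF contH, of K])
      fix x :: "real^'n" assume "norm x \<ge> K"
      then have "(norm x)\<^sup>2 \<ge> K\<^sup>2" using K by (intro power_mono) auto
      then show "H x = 0" using \<zeta>0 by (simp add: H_def \<phi>_def \<phi>'_def)
    qed
    define L where "L x = indicator (cball 0 (K / 2)) x * grad_sq x / 4
      - (M' * indicator (cball 0 R) x + 8 * (real ?n)\<^sup>2 * C / K ^ ?n * indicator (cball 0 K) x)" for x :: "real^'n"
    have le: "L x \<le> H x" for x
    proof -
      define s where "s = (norm x)\<^sup>2"
      have s0: "s \<ge> 0" by (simp add: s_def)
      have cross: "4 * \<zeta> s * \<psi> s * (u x - b) * D1 x x
          \<le> \<phi> s * grad_sq x / 2 + 8 * (real ?n)\<^sup>2 * C / K ^ ?n * indicator (cball 0 K) x"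
      proof (cases "norm x \<le> K")
        case False
        then have "s \<ge> K\<^sup>2" unfolding s_def using K by (intro power_mono) auto
        then show ?thesis using \<zeta>0 False by (simp add: \<phi>_def)
      next
        case True
        define p where "p = \<zeta> s * sqrt (grad_sq x)"
        define q where "q = \<psi> s * \<bar>u x - b\<bar> * sqrt s"
        have \<psi>0: "\<psi> s \<ge> 0" unfolding \<psi>_def using s0 by simp
        have "\<bar>D1 x x\<bar> \<le> sqrt (s * grad_sq x)"
          by (rule real_le_rsqrt) (use radial_derivative_sq_le[of x] in \<open>simp add: s_def\<close>)
        then have X: "\<bar>D1 x x\<bar> \<le> sqrt s * sqrt (grad_sq x)" by (simp add: real_sqrt_mult)
        have "4 * \<zeta> s * \<psi> s * (u x - b) * D1 x x \<le> \<bar>4 * \<zeta> s * \<psi> s * (u x - b) * D1 x x\<bar>" by simp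
        also have "\<dots> = 4 * \<zeta> s * \<psi> s * \<bar>u x - b\<bar> * \<bar>D1 x x\<bar>"
          using \<zeta>01[OF s0] \<psi>0 by (simp add: abs_mult)
        also have "\<dots> \<le> 4 * \<zeta> s * \<psi> s * \<bar>u x - b\<bar> * (sqrt s * sqrt (grad_sq x))"
          using \<zeta>01[OF s0] \<psi>0 X by (intro mult_left_mono) auto
        also have "\<dots> = 4 * p * q" by (simp add: p_def q_def)
        \<comment> \<open>Young's inequality, weighted so that half of the energy term
          remains.\<close>
        also have "\<dots> \<le> p\<^sup>2 / 2 + 8 * q\<^sup>2"
          using zero_le_power2[of "p - 4 * q"] by (simp add: power2_eq_square algebra_simps)
        also have "p\<^sup>2 = \<phi> s * grad_sq x"
          using grad_sq_nonneg[of x] by (simp add: p_def \<phi>_def power_mult_distrib)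
        also have "q\<^sup>2 \<le> (real ?n)\<^sup>2 * C / K ^ ?n"
        proof -
          define t where "t = norm x / K"
          have t: "0 \<le> t" "t \<le> 1" using True K by (auto simp: t_def)
          have st: "s / K\<^sup>2 = t\<^sup>2" by (simp add: s_def t_def power_divide)
          obtain k where k: "?n = k + 2" using n by (metis add.commute le_Suc_ex)
          have "q\<^sup>2 = (real ?n)\<^sup>2 * ((t\<^sup>2) ^ (k + 1))\<^sup>2 / (K\<^sup>2)\<^sup>2 * (u x - b)\<^sup>2 * s"
            unfolding q_def \<psi>_def st k using s0 by (simp add: power_mult_distrib power_divide)
          \<comment> \<open>With k = n - 2 the power of t is 4 k + 6: the factor t^k meets the decay
            bound, and t^(3 k + 6) is at most 1.\<close>
          also have "\<dots> = (real ?n)\<^sup>2 * (t ^ (3 * k + 6) * (t ^ k * (u x - b)\<^sup>2)) / K\<^sup>2"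
          proof -
            have "s = t\<^sup>2 * K\<^sup>2" using st K2 by (simp add: field_simps)
            moreover have "((t\<^sup>2) ^ (k + 1))\<^sup>2 * t\<^sup>2 = t ^ (3 * k + 6) * t ^ k"
            proof -
              have "((t\<^sup>2) ^ (k + 1))\<^sup>2 * t\<^sup>2 = t ^ (2 * (k + 1) * 2 + 2)"
                by (simp only: power_mult power_add)
              also have "2 * (k + 1) * 2 + 2 = (3 * k + 6) + k" by simp
              finally show ?thesis by (simp only: power_add)
            qed
            moreover have "c * A / (K\<^sup>2)\<^sup>2 * w * (T * K\<^sup>2) = c * (A * T * w) / K\<^sup>2" for c A w T
              using K2 by (simp add: power2_eq_square)
            ultimately show ?thesis by (metis mult.assoc)
          qed
          also have "\<dots> \<le> (real ?n)\<^sup>2 * (1 * (t ^ k * (u x - b)\<^sup>2)) / K\<^sup>2"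
            using t by (intro divide_right_mono mult_left_mono mult_right_mono power_le_one) auto
          also have "t ^ k * (u x - b)\<^sup>2 = norm x ^ (?n - 2) * (u x - b)\<^sup>2 / K ^ k"
            by (simp add: t_def power_divide k)
          also have "(real ?n)\<^sup>2 * (1 * (norm x ^ (?n - 2) * (u x - b)\<^sup>2 / K ^ k)) / K\<^sup>2 \<le> (real ?n)\<^sup>2 * (1 * (C / K ^ k)) / K\<^sup>2"
            using C[of x] K by (intro divide_right_mono mult_left_mono) auto
          also have "\<dots> = (real ?n)\<^sup>2 * C / K ^ ?n"
            unfolding k by (simp add: power_add power2_eq_square)
          finally show ?thesis .
        qed
        finally show ?thesis using True by simp
      qed
      have "\<phi> s * ((u x - b) * g (u x)) \<ge> - M' * indicator (cball 0 R) x"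
      proof -
        have "\<phi> s \<le> 1" "\<phi> s \<ge> 0" using \<zeta>01[OF s0] by (auto simp: \<phi>_def power_le_one)
        then have "\<phi> s * (M' * indicator (cball 0 R) x) \<le> M' * indicator (cball 0 R) x"
          using M'0 by (intro mult_left_le_one_le) auto
        moreover have "\<phi> s * ((u x - b) * g (u x)) \<ge> \<phi> s * (- M' * indicator (cball 0 R) x)"
          using M'[of x] \<open>\<phi> s \<ge> 0\<close> by (intro mult_left_mono) auto
        ultimately show ?thesis by simp
      qed
      \<comment> \<open>On the half ball the cut-off is at least 3/4, so its square exceeds
        1/2.\<close>
      moreover have "indicator (cball 0 (K / 2)) x * grad_sq x / 4 \<le> \<phi> s * grad_sq x / 2"
      proof (cases "norm x \<le> K / 2")
        case True
        have "s \<le> (K / 2)\<^sup>2" unfolding s_def using True by (intro power_mono) auto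
        then have "s / K\<^sup>2 \<le> 1 / 4" using K2 by (simp add: field_simps power2_eq_square)
        then have "(s / K\<^sup>2) ^ ?n \<le> (1 / 4) ^ ?n" using s0 by (intro power_mono) auto
        also have "\<dots> \<le> (1 / 4) ^ 1" using n by (intro power_decreasing) auto
        finally have "\<zeta> s \<ge> 3 / 4" by (simp add: \<zeta>_def)
        then have "\<phi> s \<ge> (3 / 4)\<^sup>2" unfolding \<phi>_def by (intro power_mono) auto
        then have "\<phi> s \<ge> 1 / 2" by (simp add: power2_eq_square)
        then have "\<phi> s * grad_sq x \<ge> 1 / 2 * grad_sq x" using grad_sq_nonneg by (intro mult_right_mono) auto
        then show ?thesis using True by simp
      next
        case False
        then show ?thesis using grad_sq_nonneg[of x] by (simp add: \<phi>_def)
      qed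
      ultimately show ?thesis using cross unfolding L_def H_def s_def[symmetric] \<phi>'_def
        by (simp add: algebra_simps)
    qed
    have i1: "integrable lborel (\<lambda>x. indicator (cball 0 (K / 2)) x * grad_sq x)"
      by (rule integrable_indicator_cball[OF cont_grad_sq])
    have i2: "integrable lborel (indicator (cball (0::real^'n) r) :: _ \<Rightarrow> real)" for r
      using integrable_indicator_cball[of "\<lambda>_::real^'n. 1" 0 r] by simp
    have "integral\<^sup>L lborel L \<le> 0"
      unfolding int0[symmetric]
      by (rule integral_mono[OF _ intH le])
        (unfold L_def, intro Bochner_Integration.integrable_diff Bochner_Integration.integrable_add
          integrable_divide integrable_mult_right i1 i2)
    also have "integral\<^sup>L lborel L = (LINT x|lborel. indicator (cball 0 (K / 2)) x * grad_sq x) / 4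
        - (M' * measure lborel (cball (0::real^'n) R)
          + 8 * (real ?n)\<^sup>2 * C / K ^ ?n * measure lborel (cball (0::real^'n) K))"
      unfolding L_def using i1 i2 by (simp add: Bochner_Integration.integral_diff)
    also have "8 * (real ?n)\<^sup>2 * C / K ^ ?n * measure lborel (cball (0::real^'n) K) = 8 * (real ?n)\<^sup>2 * C * \<omega>"
      using K by (simp add: measure_cball_0 \<omega>_def)
    finally show ?thesis by (simp add: B_def)
  qed
  show thesis
  proof (rule that)
    show "(LINT x|lborel. indicator (cball 0 K) x * grad_sq x) \<le> 2 * B" if "K > 0" for K
      using cut[of "2 * K"] that by simp
  qed
qed

lemma finite_energy:
  assumes "\<And>K. K > 0 \<Longrightarrow> (LINT x|lborel. indicator (cball 0 K) x * grad_sq x) \<le> B"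
  shows "integrable lborel grad_sq"
proof -
  define f where "f k x = indicator (cball 0 (real (Suc k))) x * grad_sq x" for k x
  have int: "integrable lborel (f k)" for k
    unfolding f_def by (rule integrable_indicator_cball[OF cont_grad_sq])
  have mono: "f k x \<le> f l x" if "k \<le> l" for k l x
    unfolding f_def using that grad_sq_nonneg[of x] by (intro mult_right_mono) (auto simp: indicator_def)
  have "incseq (\<lambda>k. integral\<^sup>L lborel (f k))"
    by (intro incseq_SucI integral_mono int mono) auto
  moreover have "integral\<^sup>L lborel (f k) \<le> B" for k
    using assms[of "real (Suc k)"] unfolding f_def by simp
  ultimately obtain l where l: "(\<lambda>k. integral\<^sup>L lborel (f k)) \<longlonglongrightarrow> l"
    using incseq_convergent[of "\<lambda>k. integral\<^sup>L lborel (f k)" B] by blast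
  show ?thesis
  proof (rule integrable_monotone_convergence[OF int _ _ l])
    show "AE x in lborel. mono (\<lambda>k. f k x)" by (intro AE_I2 monoI mono)
    show "AE x in lborel. (\<lambda>k. f k x) \<longlonglongrightarrow> grad_sq x"
    proof (intro AE_I2 tendsto_eventually)
      fix x :: "real^'n"
      obtain N where "norm x \<le> real N" using real_arch_simple by blast
      then have "f k x = grad_sq x" if "k \<ge> N" for k using that by (simp add: f_def indicator_def)
      then show "eventually (\<lambda>k. f k x = grad_sq x) sequentially"
        by (auto simp: eventually_sequentially)
    qed
    show "grad_sq \<in> borel_measurable lborel"
      using borel_measurable_continuous_onI[OF cont_grad_sq] by simp
  qed
qed

end

section \<open>Vanishing of the potential\<close>

text \<open>A function tending to 0 has ball averages tending to 0 even if it is not integrable.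
  Applied to W(u), this removes the cut-off error in the Pohozaev inequality.\<close>

lemma ball_average_small:
  fixes h :: "real ^ 'n::finite \<Rightarrow> real"
  assumes cont: "continuous_on UNIV h" and lim: "\<And>\<delta>. \<delta> > 0 \<Longrightarrow> \<exists>K. \<forall>x. norm x \<ge> K \<longrightarrow> h x < \<delta>"
    and nonneg: "\<And>x. h x \<ge> 0" and e: "\<epsilon> > 0"
  shows "\<exists>K\<^sub>0>0. \<forall>K\<ge>K\<^sub>0. (LINT x|lborel. indicator (cball 0 K) x * h x) \<le> \<epsilon> * K ^ CARD('n)"
proof -
  define \<omega> where "\<omega> = unit_ball_vol (real CARD('n))"
  have \<omega>: "\<omega> \<ge> 0" by (simp add: \<omega>_def unit_ball_vol_nonneg)
  define \<delta> where "\<delta> = \<epsilon> / (2 * (\<omega> + 1))"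
  have \<delta>: "\<delta> > 0" "\<delta> * \<omega> \<le> \<epsilon> / 2" using e \<omega> by (auto simp: \<delta>_def field_simps)
  obtain K1 where K1: "\<And>x. norm x \<ge> K1 \<Longrightarrow> h x < \<delta>" using lim[OF \<delta>(1)] by blast
  define I where "I = (LINT x|lborel. indicator (cball 0 K1) x * h x)"
  have int: "integrable lborel (\<lambda>x. indicator (cball 0 r) x * h x)" for r
    by (rule integrable_indicator_cball[OF cont])
  have int1: "integrable lborel (indicator (cball (0::real^'n) r) :: _ \<Rightarrow> real)" for r
    using integrable_indicator_cball[of "\<lambda>_::real^'n. 1" 0 r] by simp
  show ?thesis
  proof (intro exI[of _ "max 1 (2 * I / \<epsilon>)"] conjI allI impI)
    fix K :: real assume K: "K \<ge> max 1 (2 * I / \<epsilon>)"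
    have "(LINT x|lborel. indicator (cball 0 K) x * h x)
        \<le> (LINT x|lborel. indicator (cball 0 K1) x * h x + \<delta> * indicator (cball 0 K) x)"
    proof (rule integral_mono[OF int])
      show "integrable lborel (\<lambda>x. indicator (cball 0 K1) x * h x + \<delta> * indicator (cball 0 K) x)"
        by (intro Bochner_Integration.integrable_add integrable_mult_right int int1)
      show "indicator (cball 0 K) x * h x \<le> indicator (cball 0 K1) x * h x + \<delta> * indicator (cball 0 K) x" for x
        using K1[of x] nonneg[of x] \<delta>(1) by (auto simp: indicator_def)
    qed
    also have "\<dots> = I + \<delta> * measure lborel (cball (0::real^'n) K)"
      using int int1 by (simp add: I_def)
    also have "\<dots> = I + \<delta> * \<omega> * K ^ CARD('n)" using K by (simp add: measure_cball_0 \<omega>_def)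
    also have "\<dots> \<le> \<epsilon> / 2 * K ^ CARD('n) + \<epsilon> / 2 * K ^ CARD('n)"
    proof (rule add_mono)
      have "K ^ 1 \<le> K ^ CARD('n)" using K by (intro power_increasing) auto
      then have "2 * I / \<epsilon> \<le> K ^ CARD('n)" using K by simp
      then show "I \<le> \<epsilon> / 2 * K ^ CARD('n)" using e by (simp add: field_simps)
      show "\<delta> * \<omega> * K ^ CARD('n) \<le> \<epsilon> / 2 * K ^ CARD('n)"
        using \<delta>(2) K by (intro mult_right_mono) auto
    qed
    finally show "(LINT x|lborel. indicator (cball 0 K) x * h x) \<le> \<epsilon> * K ^ CARD('n)"
      by (simp add: field_simps)
  qed simp
qed

context C2_fun
begin

text \<open>The weight \<open>(r\<^sup>2 + \<bar>x\<bar>\<^sup>2)\<^bsup>-n/2\<^esup>\<close> is chosen since it makes the potential terms in the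
  Pohozaev identity cancel at leading order for \<open>\<bar>x\<bar> \<ge> r\<close>; \<open>K\<close> is a cut-off radius.\<close>

lemma weighted_pohozaev_inequality:
  assumes lap: "\<And>x. laplacian u x = g (u x)" and g_cont: "continuous_on UNIV g"
    and W: "\<And>s. (W has_real_derivative g s) (at s)" and W0: "\<And>s. W s \<ge> 0"
    and n: "CARD('n) \<ge> 2" and energy: "integrable lborel grad_sq"
    and r: "r > 0" and K: "K \<ge> r" and large: "(2 * r\<^sup>2) powr (real CARD('n) / 2) \<le> K ^ CARD('n) / 2"
  shows "2 powr - (real CARD('n) / 2) / 8 * (LINT x|lborel. indicator (cball 0 r) x * W (u x))
    \<le> 2 * (r ^ CARD('n) / K ^ CARD('n)) * (LINT x|lborel. indicator (cball 0 K) x * W (u x))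
      + 3 / 2 * (LINT x|lborel. (norm x)\<^sup>2 / (r\<^sup>2 + (norm x)\<^sup>2) * grad_sq x)"
proof -
  define n where "n = real CARD('n)"
  define \<beta> where "\<beta> = n / 2"
  define \<epsilon> where "\<epsilon> = 1 / K ^ CARD('n)"
  define q where "q s = r\<^sup>2 + s" for s
  \<comment> \<open>Cutting off by the inverse of the weight itself keeps the derivative simple: the
    cut-off adds just \<open>2 * \<epsilon> * m s\<close> in \<open>f'\<close>. It vanishes for s >=
    K^2, because \<open>q s powr \<beta>\<close> is then at least K^n = 1/\<epsilon>.\<close>
  define m where "m s = max 0 (1 - \<epsilon> * q s powr \<beta>)" for s
  define f where "f s = q s powr (-\<beta>) * (m s)\<^sup>2" for s
  define f' where "f' s = - (\<beta> / q s) * (f s + 2 * \<epsilon> * m s)" for s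
  have n2: "n \<ge> 2" "\<beta> \<ge> 1" using n by (simp_all add: n_def \<beta>_def)
  have Kpos: "K > 0" using K r by simp
  have \<epsilon>: "\<epsilon> > 0" using Kpos by (simp add: \<epsilon>_def)
  have powr_half: "(\<rho>\<^sup>2) powr \<beta> = \<rho> ^ CARD('n)" if "\<rho> > 0" for \<rho>
  proof -
    have "(\<rho>\<^sup>2) powr \<beta> = (\<rho> powr 2) powr \<beta>" using that by simp
    also have "\<dots> = \<rho> powr (real CARD('n))" unfolding powr_powr by (simp add: \<beta>_def n_def)
    finally show ?thesis using that by (simp add: powr_realpow)
  qed
  have r2: "r\<^sup>2 > 0" using r by simp
  have qpos: "q s > 0" "q s \<ge> r\<^sup>2" if "s \<ge> 0" for s using that r2 unfolding q_def by linarith+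
  have m01: "0 \<le> m s" "m s \<le> 1" for s using \<epsilon> by (auto simp: m_def)
  have m0: "m s = 0" if "s \<ge> K\<^sup>2" for s
  proof -
    have "K\<^sup>2 \<le> q s" unfolding q_def using that r2 by linarith
    then have "(K\<^sup>2) powr \<beta> \<le> q s powr \<beta>" using n2 by (intro powr_mono2) auto
    then have "1 \<le> \<epsilon> * q s powr \<beta>" using Kpos by (simp add: powr_half \<epsilon>_def field_simps)
    then show ?thesis by (simp add: m_def)
  qed
  have f0: "f s \<ge> 0" for s by (simp add: f_def)
  have DER: "(f has_real_derivative f' s) (at s)" if "s \<ge> 0" for s
  proof -
    have Dq: "(q has_real_derivative 1) (at s)" unfolding q_def by (auto intro!: derivative_eq_intros)
    have Dp: "((\<lambda>s. q s powr c) has_real_derivative c * q s powr (c - 1)) (at s)" for c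
      using DERIV_chain2[OF has_real_derivative_powr[OF qpos(1)[OF that]] Dq] by simp
    have "((\<lambda>s. (m s)\<^sup>2) has_real_derivative 2 * m s * - (\<epsilon> * (\<beta> * q s powr (\<beta> - 1)))) (at s)"
      unfolding m_def
      by (rule DERIV_cong[OF DERIV_chain2[OF has_real_derivative_max0_sq
              DERIV_diff[OF DERIV_const DERIV_cmult[OF Dp]]]]) simp
    from DERIV_mult[OF Dp[of "-\<beta>"] this]
    have D: "(f has_real_derivative - \<beta> * q s powr (-\<beta> - 1) * (m s)\<^sup>2
        + 2 * m s * - (\<epsilon> * (\<beta> * q s powr (\<beta> - 1))) * q s powr (-\<beta>)) (at s)"
      unfolding f_def .
    have "q s powr (-\<beta> - 1) = q s powr (-\<beta>) / q s" "q s powr (\<beta> - 1) * q s powr (-\<beta>) = 1 / q s"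
      using qpos[OF that] by (simp_all add: powr_diff powr_minus)
    then show ?thesis
      using D unfolding f'_def f_def by (elim DERIV_cong) (simp add: algebra_simps)
  qed
  have cont: "continuous_on {0..} f'" "continuous_on {0..} f"
  proof -
    have cq: "continuous_on {0..} q" unfolding q_def by (intro continuous_intros)
    have nz: "\<forall>s\<in>{0..}. q s \<noteq> 0" using qpos(1) by force
    have cm: "continuous_on {0..} m" unfolding m_def by (intro continuous_intros cq nz)
    show cf: "continuous_on {0..} f" unfolding f_def by (intro continuous_intros cq nz cm)
    show "continuous_on {0..} f'" unfolding f'_def by (intro continuous_intros cq nz cm cf)
  qed
  have supp: "f s = 0" "f' s = 0" if "s \<ge> K\<^sup>2" for s using m0[OF that] by (auto simp: f_def f'_def)
  define e where "e x = grad_sq x / 2 + W (u x)" for x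
  define H where "H x = 2 * f' ((norm x)\<^sup>2) * ((D1 x x)\<^sup>2 - (norm x)\<^sup>2 * e x)
    + f ((norm x)\<^sup>2) * (grad_sq x - n * e x)" for x
  have int0: "integral\<^sup>L lborel H = 0"
    unfolding H_def e_def n_def
    by (rule pohozaev_identity[OF DER cont(1) supp _ lap W g_cont]) (use Kpos in auto)
  have contW: "continuous_on UNIV (\<lambda>x. W (u x))"
    by (intro continuous_on_compose2[OF _ cont_u, of UNIV] continuous_at_imp_continuous_on ballI DERIV_isCont[OF W]) auto
  have intH: "integrable lborel H"
  proof (rule continuous_compact_support_integrable[where K = K])
    show "continuous_on UNIV H" unfolding H_def e_def
      by (intro continuous_intros contW cont_radial[OF cont(1)] cont_radial[OF cont(2)]) auto
    fix x :: "real^'n" assume "norm x \<ge> K"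
    then have "(norm x)\<^sup>2 \<ge> K\<^sup>2" using Kpos by (intro power_mono) auto
    then show "H x = 0" using supp by (simp add: H_def)
  qed
  define P where "P = (r\<^sup>2) powr (-\<beta>)"
  have P: "P > 0" "P = 1 / r ^ CARD('n)" using r powr_half[OF r] by (auto simp: P_def powr_minus field_simps)
  define c where "c = 2 powr (-\<beta>) / 8"
  define U where "U x = 2 * \<epsilon> * (indicator (cball 0 K) x * W (u x))
      + 3 / 2 * P * ((norm x)\<^sup>2 / (r\<^sup>2 + (norm x)\<^sup>2) * grad_sq x)
      - c * P * (indicator (cball 0 r) x * W (u x))" for x
  have le: "H x \<le> n * U x" for x
  proof -
    define s where "s = (norm x)\<^sup>2"
    have s: "s \<ge> 0" by (simp add: s_def)
    note q = qpos[OF s]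
    define \<rho> where "\<rho> = n / q s * (f s + 2 * \<epsilon> * m s)"
    have \<rho>: "\<rho> \<ge> 0" unfolding \<rho>_def using n2 q f0 \<epsilon> m01 by (intro mult_nonneg_nonneg add_nonneg_nonneg) auto
    have "s \<le> q s" unfolding q_def using r2 by linarith
    then have sq: "0 \<le> s / q s" "s / q s \<le> 1" using s q(1) by (simp_all add: divide_le_eq_1)
    have G: "grad_sq x \<ge> 0" by (rule grad_sq_nonneg)
    have Wx: "W (u x) \<ge> 0" by (rule W0)
    have "H x = - \<rho> * (D1 x x)\<^sup>2 + \<rho> * s * e x + f s * (grad_sq x - n * e x)"
    proof -
      have "2 * f' s = - \<rho>" by (simp add: f'_def \<rho>_def \<beta>_def)
      then show ?thesis unfolding H_def s_def[symmetric] by (simp add: right_diff_distrib)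
    qed
    \<comment> \<open>The weight is decreasing, so the squared radial derivative enters with a
      favourable sign and is dropped.\<close>
    also have "\<dots> \<le> \<rho> * s * e x + f s * (grad_sq x - n * e x)" using \<rho> by simp
    also have "\<dots> = (\<rho> * s - n * f s) * W (u x) + \<rho> * s / 2 * grad_sq x + (1 - n / 2) * f s * grad_sq x"
      by (simp add: e_def algebra_simps)
    \<comment> \<open>Here n >= 2 makes the coefficient 1 - n/2 nonpositive.\<close>
    also have "\<dots> \<le> (\<rho> * s - n * f s) * W (u x) + \<rho> * s / 2 * grad_sq x"
    proof -
      have "(1 - n / 2) * (f s * grad_sq x) \<le> 0"
        using n2 f0[of s] G by (intro mult_nonpos_nonneg mult_nonneg_nonneg) auto
      then show ?thesis by simp
    qed
    also have "\<dots> \<le> n * (2 * \<epsilon> * indicator (cball 0 K) x - c * P * indicator (cball 0 r) x) * W (u x)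
        + n * (3 / 2 * P * (s / q s)) * grad_sq x"
    proof (intro add_mono mult_right_mono G Wx)
      have fP: "f s \<le> P"
      proof -
        have "q s powr (-\<beta>) \<le> P" unfolding P_def using q r2 n2 by (intro powr_mono2') auto
        moreover have "(m s)\<^sup>2 \<le> 1" using m01 by (simp add: power_le_one)
        ultimately have "q s powr (-\<beta>) * (m s)\<^sup>2 \<le> P * 1" using P by (intro mult_mono) auto
        then show ?thesis by (simp add: f_def)
      qed
      have \<epsilon>P: "\<epsilon> \<le> P"
        unfolding P \<epsilon>_def using K r by (intro divide_left_mono power_mono) auto
      have "\<epsilon> * m s \<le> P * 1" using \<epsilon>P \<epsilon> m01 P by (intro mult_mono) auto
      \<comment> \<open>The 3 combines \<open>f s \<le> P\<close> with \<epsilon> m <= P taken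
        twice; halved, it is the constant 3/2 of the statement.\<close>
      then have "f s + 2 * \<epsilon> * m s \<le> 3 * P" using fP by simp
      then have "n * (s / q s) * (f s + 2 * \<epsilon> * m s) \<le> n * (s / q s) * (3 * P)"
        using n2 sq by (intro mult_left_mono mult_nonneg_nonneg) auto
      then show "\<rho> * s / 2 \<le> n * (3 / 2 * P * (s / q s))"
        by (simp add: \<rho>_def algebra_simps)
      \<comment> \<open>Since s/q = 1 - r^2/q, the terms n f cancel and leave the share r^2/q, which
        is at least 1/2 on the ball of radius r.\<close>
      have "\<rho> * s - n * f s = n * (2 * \<epsilon> * m s * (s / q s) - f s * (r\<^sup>2 / q s))"
      proof -
        define k where "k = r\<^sup>2 / q s"
        have k: "s / q s = 1 - k" using q by (simp add: field_simps q_def k_def)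
        have "\<rho> * s = n * (f s + 2 * \<epsilon> * m s) * (s / q s)" by (simp add: \<rho>_def)
        then show ?thesis unfolding k k_def[symmetric] by (simp add: algebra_simps)
      qed
      also have "\<dots> \<le> n * (2 * \<epsilon> * indicator (cball 0 K) x - c * P * indicator (cball 0 r) x)"
      proof (intro mult_left_mono diff_mono)
        show "2 * \<epsilon> * m s * (s / q s) \<le> 2 * \<epsilon> * indicator (cball 0 K) x"
        proof (cases "norm x \<le> K")
          case True
          have "m s * (s / q s) \<le> 1 * 1" using m01 sq by (intro mult_mono) auto
          then have "2 * \<epsilon> * (m s * (s / q s)) \<le> 2 * \<epsilon> * 1" using \<epsilon> by (intro mult_left_mono) auto
          then show ?thesis using True by (simp add: mult.assoc)
        next
          case False
          then have "s \<ge> K\<^sup>2" unfolding s_def using Kpos by (intro power_mono) auto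
          then show ?thesis using m0 False by simp
        qed
        show "c * P * indicator (cball 0 r) x \<le> f s * (r\<^sup>2 / q s)"
        proof (cases "norm x \<le> r")
          case True
          then have "s \<le> r\<^sup>2" unfolding s_def by (intro power_mono) auto
          then have q2: "q s \<le> 2 * r\<^sup>2" by (simp add: q_def)
          \<comment> \<open>This is where \<open>large\<close> enters: K is so big compared with r
            that the cut-off is still at least 1/2 on the small ball.\<close>
          have "q s powr \<beta> \<le> (2 * r\<^sup>2) powr \<beta>" using q q2 n2 by (intro powr_mono2) auto
          also have "\<dots> \<le> K ^ CARD('n) / 2" using large by (simp add: \<beta>_def n_def)
          finally have "\<epsilon> * q s powr \<beta> \<le> 1 / 2" using Kpos by (simp add: \<epsilon>_def field_simps)
          then have "m s \<ge> 1 / 2" by (simp add: m_def)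
          then have "(m s)\<^sup>2 \<ge> (1 / 2)\<^sup>2" by (intro power_mono) auto
          then have m2: "(m s)\<^sup>2 \<ge> 1 / 4" by (simp add: power2_eq_square)
          have "2 powr (-\<beta>) * P = (2 * r\<^sup>2) powr (-\<beta>)" using r2 by (simp add: P_def powr_mult)
          also have "\<dots> \<le> q s powr (-\<beta>)" using q q2 n2 by (intro powr_mono2') auto
          finally have "2 powr (-\<beta>) * P * (1 / 4) \<le> q s powr (-\<beta>) * (m s)\<^sup>2"
            by (rule mult_mono) (use m2 P in auto)
          moreover have "1 / 2 \<le> r\<^sup>2 / q s" using q q2 by (simp add: field_simps)
          ultimately have "2 powr (-\<beta>) * P * (1 / 4) * (1 / 2) \<le> f s * (r\<^sup>2 / q s)"
            unfolding f_def by (rule mult_mono) (use P in auto)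
          then show ?thesis using True by (simp add: c_def)
        next
          case False
          moreover have "0 \<le> f s * (r\<^sup>2 / q s)"
            using f0[of s] q(1) by (intro mult_nonneg_nonneg divide_nonneg_pos) auto
          ultimately show ?thesis by simp
        qed
      qed (use n2 in simp)
      finally show "\<rho> * s - n * f s \<le> n * (2 * \<epsilon> * indicator (cball 0 K) x - c * P * indicator (cball 0 r) x)" .
    qed
    also have "\<dots> = n * U x" unfolding U_def s_def[symmetric] q_def by (simp add: algebra_simps)
    finally show ?thesis .
  qed
  have i1: "integrable lborel (\<lambda>x. indicator (cball 0 \<rho>) x * W (u x))" for \<rho>
    by (rule integrable_indicator_cball[OF contW])
  have i2: "integrable lborel (\<lambda>x. (norm x)\<^sup>2 / (r\<^sup>2 + (norm x)\<^sup>2) * grad_sq x)"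
  proof (rule Bochner_Integration.integrable_bound[OF energy])
    have "continuous_on UNIV (\<lambda>x. (norm x)\<^sup>2 / (r\<^sup>2 + (norm x)\<^sup>2) * grad_sq x)"
      using r2 by (intro continuous_intros cont_grad_sq) (simp add: add_pos_nonneg less_imp_neq[symmetric])
    then show "(\<lambda>x. (norm x)\<^sup>2 / (r\<^sup>2 + (norm x)\<^sup>2) * grad_sq x) \<in> borel_measurable lborel"
      using borel_measurable_continuous_onI by simp
    have "(norm x)\<^sup>2 / (r\<^sup>2 + (norm x)\<^sup>2) * grad_sq x \<le> 1 * grad_sq x" for x :: "real^'n"
      using r2 grad_sq_nonneg[of x] by (intro mult_right_mono) (auto simp: add_pos_nonneg)
    then show "AE x in lborel. norm ((norm x)\<^sup>2 / (r\<^sup>2 + (norm x)\<^sup>2) * grad_sq x) \<le> norm (grad_sq x)"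
      using grad_sq_nonneg by (intro AE_I2) (simp add: abs_mult)
  qed
  have iU: "integrable lborel U"
    unfolding U_def
    by (intro Bochner_Integration.integrable_diff Bochner_Integration.integrable_add integrable_mult_right i1 i2)
  have "0 \<le> (LINT x|lborel. n * U x)"
    unfolding int0[symmetric] by (rule integral_mono[OF intH _ le]) (intro integrable_mult_right iU)
  then have "0 \<le> integral\<^sup>L lborel U" using n2 by (simp add: zero_le_mult_iff)
  also have "integral\<^sup>L lborel U = 2 * \<epsilon> * (LINT x|lborel. indicator (cball 0 K) x * W (u x))
      + 3 / 2 * P * (LINT x|lborel. (norm x)\<^sup>2 / (r\<^sup>2 + (norm x)\<^sup>2) * grad_sq x)
      - c * P * (LINT x|lborel. indicator (cball 0 r) x * W (u x))"
    unfolding U_def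
    by (subst Bochner_Integration.integral_diff Bochner_Integration.integral_add integral_mult_right_zero;
        (intro Bochner_Integration.integrable_diff Bochner_Integration.integrable_add integrable_mult_right i1 i2)?)+ simp
  finally have "c * P * (LINT x|lborel. indicator (cball 0 r) x * W (u x))
      \<le> 2 * \<epsilon> * (LINT x|lborel. indicator (cball 0 K) x * W (u x))
        + 3 / 2 * P * (LINT x|lborel. (norm x)\<^sup>2 / (r\<^sup>2 + (norm x)\<^sup>2) * grad_sq x)" by simp
  then have "r ^ CARD('n) * (c * P * (LINT x|lborel. indicator (cball 0 r) x * W (u x)))
      \<le> r ^ CARD('n) * (2 * \<epsilon> * (LINT x|lborel. indicator (cball 0 K) x * W (u x))
        + 3 / 2 * P * (LINT x|lborel. (norm x)\<^sup>2 / (r\<^sup>2 + (norm x)\<^sup>2) * grad_sq x))"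
    using r by (intro mult_left_mono) auto
  moreover have rP: "r ^ CARD('n) * P = 1" using r P by simp
  have "r ^ CARD('n) * (c * P * z) = c * z" for z
    using rP by (metis mult.assoc mult.commute mult.left_neutral)
  moreover have "r ^ CARD('n) * (2 * \<epsilon> * y + 3 / 2 * P * z) = 2 * (r ^ CARD('n) / K ^ CARD('n)) * y + 3 / 2 * z" for y z
  proof -
    have "r ^ CARD('n) * (2 * \<epsilon> * y + 3 / 2 * P * z)
        = 2 * (r ^ CARD('n) / K ^ CARD('n)) * y + 3 / 2 * (r ^ CARD('n) * P) * z"
      by (simp add: \<epsilon>_def algebra_simps)
    then show ?thesis unfolding rP by simp
  qed
  ultimately show ?thesis unfolding c_def \<beta>_def n_def by (simp only:)
qed

text \<open>The order of limits matters: K goes to infinity at fixed r, then r does. In the second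
  limit dominated convergence applies, because the gradient weight is at most 1 and tends to 0
  pointwise.\<close>

lemma potential_vanishes:
  assumes lap: "\<And>x. laplacian u x = g (u x)" and g_cont: "continuous_on UNIV g"
    and W: "\<And>s. (W has_real_derivative g s) (at s)" and W0: "\<And>s. W s \<ge> 0"
    and n: "CARD('n) \<ge> 2" and energy: "integrable lborel grad_sq"
    and lim: "\<And>\<delta>. \<delta> > 0 \<Longrightarrow> \<exists>K. \<forall>x. norm x \<ge> K \<longrightarrow> W (u x) < \<delta>"
  shows "W (u x) = 0"
proof (rule ccontr)
  define c where "c = 2 powr - (real CARD('n) / 2) / 8"
  have c: "c > 0" by (simp add: c_def)
  define J where "J r = (LINT x|lborel. indicator (cball 0 r) x * W (u x))" for r
  define E where "E r = (LINT x|lborel. (norm x)\<^sup>2 / (r\<^sup>2 + (norm x)\<^sup>2) * grad_sq x)" for r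
  have contW: "continuous_on UNIV (\<lambda>x. W (u x))"
    by (intro continuous_on_compose2[OF _ cont_u, of UNIV] continuous_at_imp_continuous_on ballI DERIV_isCont[OF W]) auto
  have int: "integrable lborel (\<lambda>x. indicator (cball 0 r) x * W (u x))" for r
    by (rule integrable_indicator_cball[OF contW])
  have JE: "c * J r \<le> 3 / 2 * E r" if r: "r > 0" for r
  proof (rule field_le_epsilon)
    fix \<eta> :: real assume \<eta>: "\<eta> > 0"
    \<comment> \<open>This cancels the factor 2 r^n in front of the average, leaving exactly
      \<open>\<eta>\<close>.\<close>
    define \<delta> where "\<delta> = \<eta> / (2 * r ^ CARD('n))"
    have \<delta>: "\<delta> > 0" using r \<eta> by (simp add: \<delta>_def)
    obtain K0 where K0: "\<And>K. K \<ge> K0 \<Longrightarrow> J K \<le> \<delta> * K ^ CARD('n)"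
      unfolding J_def using ball_average_small[OF contW lim W0 \<delta>] by blast
    define K where "K = max (max 1 K0) (max r (2 * (2 * r\<^sup>2) powr (real CARD('n) / 2)))"
    have K: "K \<ge> 1" "K \<ge> K0" "K \<ge> r" "K \<ge> 2 * (2 * r\<^sup>2) powr (real CARD('n) / 2)"
      by (simp_all add: K_def)
    have "K ^ 1 \<le> K ^ CARD('n)" using K by (intro power_increasing) auto
    then have "(2 * r\<^sup>2) powr (real CARD('n) / 2) \<le> K ^ CARD('n) / 2" using K(4) by simp
    then have "c * J r \<le> 2 * (r ^ CARD('n) / K ^ CARD('n)) * J K + 3 / 2 * E r"
      unfolding c_def J_def E_def
      using weighted_pohozaev_inequality[OF lap g_cont W W0 n energy r K(3)] by simp
    also have "2 * (r ^ CARD('n) / K ^ CARD('n)) * J K \<le> 2 * (r ^ CARD('n) / K ^ CARD('n)) * (\<delta> * K ^ CARD('n))"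
      using r K by (intro mult_left_mono K0) auto
    also have "\<dots> = \<eta>" using r K(1) by (simp add: \<delta>_def)
    finally show "c * J r \<le> 3 / 2 * E r + \<eta>" by simp
  qed
  have E0: "(\<lambda>k. E (real (Suc k))) \<longlonglongrightarrow> 0"
  proof -
    have sq: "((real (Suc k))\<^sup>2 + (norm x)\<^sup>2) > 0" for k and x :: "real^'n"
      by (intro add_pos_nonneg) auto
    have "(\<lambda>k. E (real (Suc k))) \<longlonglongrightarrow> integral\<^sup>L lborel (\<lambda>x::real^'n. 0::real)"
      unfolding E_def
    proof (rule integral_dominated_convergence[OF _ _ energy])
      show "(\<lambda>x. (norm x)\<^sup>2 / ((real (Suc k))\<^sup>2 + (norm x)\<^sup>2) * grad_sq x) \<in> borel_measurable lborel" for k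
      proof -
        have "continuous_on UNIV (\<lambda>x. (norm x)\<^sup>2 / ((real (Suc k))\<^sup>2 + (norm x)\<^sup>2) * grad_sq x)"
          by (intro continuous_intros cont_grad_sq ballI less_imp_neq[symmetric] sq)
        then show ?thesis using borel_measurable_continuous_onI by simp
      qed
      have "(\<lambda>k. (norm x)\<^sup>2 / ((real (Suc k))\<^sup>2 + (norm x)\<^sup>2) * grad_sq x) \<longlonglongrightarrow> 0" for x :: "real^'n"
      proof (rule tendsto_mult_left_zero, rule tendsto_divide_0[OF tendsto_const])
        have "filterlim (\<lambda>k. (real (Suc k))\<^sup>2) at_top sequentially"
          by (intro filterlim_pow_at_top filterlim_compose[OF filterlim_real_sequentially filterlim_Suc]) auto
        then show "filterlim (\<lambda>k. (real (Suc k))\<^sup>2 + (norm x)\<^sup>2) at_infinity sequentially"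
          by (intro filterlim_at_top_imp_at_infinity, subst add.commute)
            (rule filterlim_tendsto_add_at_top[OF tendsto_const])
      qed
      then show "AE x in lborel. (\<lambda>k. (norm x)\<^sup>2 / ((real (Suc k))\<^sup>2 + (norm x)\<^sup>2) * grad_sq x) \<longlonglongrightarrow> 0" by simp
      have "(norm x)\<^sup>2 / ((real (Suc k))\<^sup>2 + (norm x)\<^sup>2) * grad_sq x \<le> 1 * grad_sq x" for k and x :: "real^'n"
        using sq[of k x] by (intro mult_right_mono grad_sq_nonneg) (auto simp: divide_le_eq_1)
      then show "AE x in lborel. norm ((norm x)\<^sup>2 / ((real (Suc k))\<^sup>2 + (norm x)\<^sup>2) * grad_sq x) \<le> grad_sq x" for k
        using grad_sq_nonneg sq by (intro AE_I2) (simp add: abs_mult less_imp_le)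
    qed simp
    then show ?thesis by simp
  qed
  assume "W (u x) \<noteq> 0"
  then have pos: "W (u x) > 0" using W0[of "u x"] by simp
  define \<delta> where "\<delta> = W (u x) / 2"
  have \<delta>: "\<delta> > 0" "\<delta> < W (u x)" using pos by (auto simp: \<delta>_def)
  have "open {y. \<delta> < W (u y)}" using contW by (intro open_Collect_less continuous_on_const)
  then obtain d where d: "d > 0" "ball x d \<subseteq> {y. \<delta> < W (u y)}"
    using \<delta>(2) openE by (metis mem_Collect_eq)
  define D where "D = measure lborel (ball x d)"
  have D: "D > 0" unfolding D_def using d by (simp add: content_ball_pos)
  \<comment> \<open>By continuity W(u) exceeds \<open>\<delta>\<close> on a ball around
    \<open>x\<close>, so nonnegativity bounds \<open>J\<close> from below for all large
    radii.\<close>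
  have lower: "\<delta> * D \<le> J r" if "r \<ge> norm x + d" for r
  proof -
    have i1: "integrable lborel (indicator (ball x d) :: _ \<Rightarrow> real)"
      using emeasure_lborel_ball_finite[of x d] by (simp add: integrable_indicator_iff)
    have "\<delta> * D = (LINT y|lborel. \<delta> * indicator (ball x d) y)" by (simp add: D_def)
    also have "\<dots> \<le> J r"
      unfolding J_def
    proof (rule integral_mono[OF integrable_mult_right[OF i1] int])
      show "\<delta> * indicator (ball x d) y \<le> indicator (cball 0 r) y * W (u y)" for y
      proof (cases "y \<in> ball x d")
        case True
        have "norm y \<le> r"
          using True that norm_triangle_sub[of y x] by (simp add: dist_norm norm_minus_commute)
        then show ?thesis using True d(2) by auto
      next
        case False
        then show ?thesis using W0 by simp
      qed
    qed
    finally show ?thesis .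
  qed
  have "c * (\<delta> * D) \<le> 3 / 2 * 0"
  proof (rule tendsto_lowerbound[OF tendsto_mult_left[OF E0]])
    obtain N where N: "norm x + d \<le> real N" using real_arch_simple by blast
    have "c * (\<delta> * D) \<le> 3 / 2 * E (real (Suc k))" if "k \<ge> N" for k
    proof -
      have "norm x + d \<le> real (Suc k)" using N that by simp
      then have "c * (\<delta> * D) \<le> c * J (real (Suc k))" using c lower by (intro mult_left_mono) auto
      also have "\<dots> \<le> 3 / 2 * E (real (Suc k))" by (rule JE) simp
      finally show ?thesis .
    qed
    then show "eventually (\<lambda>k. c * (\<delta> * D) \<le> 3 / 2 * E (real (Suc k))) sequentially"
      by (auto simp: eventually_sequentially)
  qed simp
  moreover have "c * (\<delta> * D) > 0" using c \<delta> D by simp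
  ultimately show False by simp
qed

end

section \<open>Conclusion from the hypotheses on the potential\<close>

lemma C11_loc_imp_deriv_continuous:
  assumes "C11_loc W"
  shows "(W has_real_derivative deriv W s) (at s)" "continuous_on UNIV (deriv W)"
proof -
  show "(W has_real_derivative deriv W s) (at s)"
    using assms by (simp add: C11_loc_def DERIV_deriv_iff_real_differentiable)
  have "continuous (at t) (deriv W)" for t
  proof -
    obtain L where "L-lipschitz_on (cball t 1) (deriv W)"
      using assms compact_cball unfolding C11_loc_def by blast
    then have "continuous_on (cball t 1) (deriv W)" by (rule lipschitz_on_continuous_on)
    then have "continuous_on (ball t 1) (deriv W)" by (rule continuous_on_subset) auto
    then show ?thesis by (simp add: continuous_on_eq_continuous_at)
  qed
  then show "continuous_on UNIV (deriv W)" by (simp add: continuous_on_eq_continuous_at)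
qed

theorem corollary1p6:
  fixes u :: "real ^ 'n::finite \<Rightarrow> real" and W :: "real \<Rightarrow> real" and a b R :: real
  assumes "CARD('n) \<ge> 2"
    and "a < b"
    and "C11_loc W"
    and "\<forall>s. 0 \<le> W s"
    and "deriv W a = 0" and "deriv W b = 0"
    and "\<forall>s\<in>{a<..<b}. deriv W s < 0"
    and "W b = 0"
    and "C2 u"
    and "\<forall>x. laplacian u x = deriv W (u x)"
    and "R > 0"
    and "\<forall>x\<in>UNIV - ball 0 R. u x \<in> {a<..b}"
    and "CARD('n) = 2 \<or>
         (CARD('n) \<ge> 3 \<and> (\<exists>C\<^sub>0>0. \<exists>s\<^sub>0\<in>{a<..<b}. \<forall>s\<in>{a..s\<^sub>0}.
            deriv W s \<le> - C\<^sub>0 * (s - a) powr (real CARD('n) / (real CARD('n) - 2))))"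
  shows "\<forall>x. u x = b"
proof -
  obtain D1 D2 where "C2_fun u D1 D2" using C2_imp_C2_fun[OF \<open>C2 u\<close>] .
  then interpret C2_fun u D1 D2 .
  define g where "g = deriv W"
  note n = \<open>CARD('n) \<ge> 2\<close> and R = \<open>R > 0\<close>
  have W: "(W has_real_derivative g s) (at s)" for s
    unfolding g_def by (rule C11_loc_imp_deriv_continuous[OF \<open>C11_loc W\<close>])
  have g_cont: "continuous_on UNIV g"
    unfolding g_def by (rule C11_loc_imp_deriv_continuous[OF \<open>C11_loc W\<close>])
  have W0: "W s \<ge> 0" for s using assms(4) by blast
  have g_neg: "g s < 0" if "a < s" "s < b" for s using assms(7) that by (simp add: g_def)
  have lap: "laplacian u x = g (u x)" for x using assms(10) by (simp add: g_def)
  have bnd: "a < u x \<and> u x \<le> b" if "norm x \<ge> R" for x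
    using assms(12) that by (simp add: not_less)
  obtain m r where m: "m > a" and r: "r \<ge> R" and low: "\<And>x. norm x \<ge> r \<Longrightarrow> m \<le> u x"
    using assms(13)
  proof (elim disjE conjE bexE exE)
    assume "CARD('n) = 2"
    from exterior_lower_bound_2d[OF this R g_neg lap bnd] show thesis using that by (metis order.refl)
  next
    fix C\<^sub>0 s\<^sub>0
    assume n3: "3 \<le> CARD('n)" and "C\<^sub>0 > 0" and s\<^sub>0: "s\<^sub>0 \<in> {a<..<b}"
      and crit: "\<forall>s\<in>{a..s\<^sub>0}. deriv W s \<le> - C\<^sub>0 * (s - a) powr (real CARD('n) / (real CARD('n) - 2))"
    have "g s \<le> - C\<^sub>0 * (s - a) powr (real CARD('n) / (real CARD('n) - 2))" if "a \<le> s" "s \<le> s\<^sub>0" for s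
      using crit that by (simp add: g_def)
    from exterior_lower_bound_ge3[OF n3 R g_neg \<open>C\<^sub>0 > 0\<close> _ _ this lap bnd, of s\<^sub>0] s\<^sub>0
    show thesis using that by (metis greaterThanLessThan_iff)
  qed
  have rpos: "r > 0" using r R by simp
  have bnd': "m \<le> u x \<and> u x \<le> b" if "norm x \<ge> r" for x using low[OF that] bnd[of x] that r by simp
  \<comment> \<open>Raising the lower bound from \<open>a\<close> to \<open>m\<close> discards the
    zero of \<open>g\<close> at \<open>a\<close>, so \<open>b\<close> is the only zero left in the
    range of \<open>u\<close> far out.\<close>
  have g_neg': "g s < 0" if "m \<le> s" "s < b" for s using g_neg that m by simp
  have lim: "\<exists>K. \<forall>x. norm x \<ge> K \<longrightarrow> b - \<epsilon> < u x" if "\<epsilon> > 0" for \<epsilon>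
    by (rule eventually_near_upper_zero[OF continuous_on_subset[OF g_cont subset_UNIV] g_neg' lap bnd' that])
  obtain C where C: "\<And>x. norm x ^ (CARD('n) - 2) * (u x - b)\<^sup>2 \<le> C"
    using decay_bound[OF n rpos g_neg' lap bnd' lim] by blast
  have sign: "(u x - b) * g (u x) \<ge> 0" if "norm x \<ge> r" for x
    using bnd'[OF that] g_neg'[of "u x"] by (cases "u x = b") (auto intro: mult_nonpos_nonpos)
  obtain B where "\<And>K. K > 0 \<Longrightarrow> (LINT x|lborel. indicator (cball 0 K) x * grad_sq x) \<le> B"
    using local_energy_bound[OF lap g_cont sign n C] by blast
  then have energy: "integrable lborel grad_sq" by (rule finite_energy)
  have W_lim: "\<exists>K. \<forall>x. norm x \<ge> K \<longrightarrow> W (u x) < \<delta>" if \<delta>: "\<delta> > 0" for \<delta>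
  proof -
    have "isCont W b" using DERIV_isCont[OF W] .
    then obtain \<epsilon> where \<epsilon>: "\<epsilon> > 0" "\<And>s. \<bar>s - b\<bar> < \<epsilon> \<Longrightarrow> \<bar>W s\<bar> < \<delta>"
      using \<delta> \<open>W b = 0\<close> unfolding continuous_at_eps_delta dist_real_def by auto
    obtain K where K: "\<And>x. norm x \<ge> K \<Longrightarrow> b - \<epsilon> < u x" using lim[OF \<epsilon>(1)] by blast
    have "W (u x) < \<delta>" if "norm x \<ge> max K r" for x
      using \<epsilon>(2)[of "u x"] K[of x] bnd'[of x] that by simp
    then show ?thesis by blast
  qed
  have zero: "W (u x) = 0" for x
    by (rule potential_vanishes[OF lap g_cont W W0 n energy W_lim])
  have "g (u x) = 0" for x
    by (rule DERIV_local_min[OF W zero_less_one]) (simp add: zero W0)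
  then have harm: "laplacian u x = 0" for x by (simp add: lap)
  have out: "u x = b" if "norm x \<ge> R" for x
  proof (rule ccontr)
    assume "u x \<noteq> b"
    then have lt: "a < u x" "u x < b" using bnd[OF that] by auto
    \<comment> \<open>W strictly decreases to 0 at \<open>b\<close>, so it cannot already vanish at
      a value between \<open>a\<close> and \<open>b\<close>.\<close>
    obtain z where "u x < z" "z < b" "W b - W (u x) = (b - u x) * g z"
      using MVT2[OF lt(2) W] by blast
    then show False using zero[of x] \<open>W b = 0\<close> g_neg[of z] lt by simp
  qed
  show ?thesis using harmonic_eq_exterior_value[OF harm out] by blast
qed

end
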